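(* (a) Let $\sigma\in\partial\mathcal{D}$ be positive definite ($\sigma>0$), and let $\rho\in \mathrm{H}_{n,+,1}$ with $\rho\neq\sigma$. Then $$E_R(\rho)=S(\rho\|\sigma)$$ (i.e. $\sigma$ is a closest separable state (CSS) of $\rho$) if and only if there exist a Hermitian matrix $\phi\in \mathrm{H}_n$ satisfying $$\mathrm{Tr}(\phi\sigma')\ge \mathrm{Tr}(\phi\sigma)=0\ \text{ for all } \sigma'\in\mathcal{D},\qquad \mathrm{Tr}(\phi^2)=1,$$ and a real number $x$ with $0<x\le x_{\max}$ such that $$\rho=\sigma-x\,L_\sigma^{-1}(\phi).$$ Here $x_{\max}=x_{\max}(\sigma,\phi)>0$ is the number such that $\sigma-x_{\max}L_\sigma^{-1}(\phi)\in \mathrm{H}_{n,+,1}$ and $\sigma-x_{\max}L_\sigma^{-1}(\phi)$ has at least one zero eigenvalue, i.e. the largest $x$ for which $\sigma-xL_\sigma^{-1}(\phi)$ is positive semidefinite. (b) If $\rho\in \mathrm{H}_{n,+,1}$ is positive definite (full rank), then the CSS of $\rho$ is unique.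
   Context: $\mathrm{H}_n$ is the real vector space of $n\times n$ complex Hermitian matrices with inner product $\mathrm{Tr}(XY)$; $\mathrm{H}_{n,+}\subset \mathrm{H}_n$ is the cone of positive semidefinite matrices, and $\mathrm{H}_{n,+,1}$ is the set of elements of $\mathrm{H}_{n,+}$ of trace one (states). $X>0$ means positive definite. Fix $n=n_1n_2\cdots n_s$ and identify $\mathbb{C}^n=\mathbb{C}^{n_1}\otimes\cdots\otimes\mathbb{C}^{n_s}$. $\mathcal{D}\subset \mathrm{H}_{n,+,1}$ denotes either the set of separable states (the convex hull of the product states $\rho_1\otimes\cdots\otimes\rho_s$ with $\rho_i\in \mathrm{H}_{n_i,+,1}$) or the set of PPT states (states all of whose partial transposes, with respect to every subset of the tensor factors, are positive semidefinite); the result is asserted for either choice. $\partial\mathcal{D}$ is the boundary of $\mathcal{D}$ relative to the affine space of trace-one Hermitian matrices. The relative entropy is $S(\rho\|\sigma)=\mathrm{Tr}(\rho\log\rho-\rho\log\sigma)$ (natural logarithm; equal to $+\infty$ if $\ker\sigma\not\subseteq\ker\rho$; $0\log 0=0$), and the relative entropy of entanglement is $E_R(\rho)=\min_{\sigma'\in\mathcal{D}}S(\rho\|\sigma')$. Any $\sigma\in\mathcal{D}$ with $E_R(\rho)=S(\rho\|\sigma)$ is called a closest separable state (CSS) of $\rho$. For $\sigma>0$, $L_\sigma:\mathrm{H}_n\to \mathrm{H}_n$ is the linear operator with $\log(\sigma+t\beta)=\log\sigma+tL_\sigma(\beta)+O(t^2)$. Explicitly, in an orthonormal eigenbasis of $\sigma$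 in which $\sigma=\mathrm{diag}(a_1,\dots,a_n)$ and $\beta=[b_{kl}]$, $[L_\sigma(\beta)]_{kl}=b_{kl}\frac{\log a_k-\log a_l}{a_k-a_l}$, with the convention that the quotient equals $1/a_k$ when $a_k=a_l$. It is invertible, with $[L_\sigma^{-1}(\beta)]_{kl}=b_{kl}\frac{a_k-a_l}{\log a_k-\log a_l}$ (the quotient being $a_k$ when $a_k=a_l$). *)

theory Defs
  imports "HOL-Analysis.Analysis"
begin

text \<open>
  The factors of \<open>\<complex>\<^sup>n = \<complex>\<^bsup>n\<^sub>1\<^esup> \<otimes> \<dots> \<otimes> \<complex>\<^bsup>n\<^sub>s\<^esup>\<close> are labelled by a finite type \<open>'s\<close> and have
  dimensions \<open>ns :: 's \<Rightarrow> nat\<close>. An operator on \<open>\<complex>\<^sup>n\<close> is a matrix \<open>complex^'n^'n\<close>, and the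
  identification with the tensor product is a bijection \<open>e\<close> from the index type \<open>'n\<close> onto the
  multi-indices \<open>{f. \<forall>i. f i < ns i}\<close>. As the \<open>ns i\<close> are not types, an operator on a single factor
  is a function \<open>nat \<Rightarrow> nat \<Rightarrow> complex\<close>, of which only the entries below \<open>ns i\<close> matter.
\<close>

definition hermitian_on :: "'i set \<Rightarrow> ('i \<Rightarrow> 'i \<Rightarrow> complex) \<Rightarrow> bool" where
  "hermitian_on I A \<longleftrightarrow> (\<forall>k\<in>I. \<forall>l\<in>I. A k l = cnj (A l k))"

definition quad_form_on :: "'i set \<Rightarrow> ('i \<Rightarrow> 'i \<Rightarrow> complex) \<Rightarrow> ('i \<Rightarrow> complex) \<Rightarrow> complex" where
  "quad_form_on I A v = (\<Sum>k\<in>I. \<Sum>l\<in>I. cnj (v k) * A k l * v l)"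

definition psd_on :: "'i set \<Rightarrow> ('i \<Rightarrow> 'i \<Rightarrow> complex) \<Rightarrow> bool" where
  "psd_on I A \<longleftrightarrow> hermitian_on I A \<and> (\<forall>v. 0 \<le> Re (quad_form_on I A v))"

definition state_on :: "'i set \<Rightarrow> ('i \<Rightarrow> 'i \<Rightarrow> complex) \<Rightarrow> bool" where
  "state_on I A \<longleftrightarrow> psd_on I A \<and> (\<Sum>k\<in>I. A k k) = 1"

abbreviation entries :: "complex^'n^'n \<Rightarrow> 'n \<Rightarrow> 'n \<Rightarrow> complex" where
  "entries A \<equiv> (\<lambda>k l. A $ k $ l)"

definition Herm :: "(complex^'n^'n) set" where
  "Herm = {A. hermitian_on UNIV (entries A)}"

definition psd :: "complex^'n^'n \<Rightarrow> bool" where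
  "psd A \<longleftrightarrow> psd_on UNIV (entries A)"

definition pos_def :: "complex^'n^'n \<Rightarrow> bool" where
  "pos_def A \<longleftrightarrow> A \<in> Herm \<and> (\<forall>v. v \<noteq> (\<lambda>_. 0) \<longrightarrow> 0 < Re (quad_form_on UNIV (entries A) v))"

definition states :: "(complex^'n^'n) set" where
  "states = {A. psd A \<and> trace A = 1}"


definition tensor :: "('n \<Rightarrow> 's::finite \<Rightarrow> nat) \<Rightarrow> ('s \<Rightarrow> nat \<Rightarrow> nat \<Rightarrow> complex) \<Rightarrow> complex^'n^'n" where
  "tensor e A = (\<chi> k l. \<Prod>i\<in>UNIV. A i (e k i) (e l i))"

definition separable_states :: "('s::finite \<Rightarrow> nat) \<Rightarrow> ('n \<Rightarrow> 's \<Rightarrow> nat) \<Rightarrow> (complex^'n^'n) set" where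
  "separable_states ns e = convex hull {tensor e A | A. \<forall>i. state_on {..<ns i} (A i)}"

text \<open>Partial transposition on the factors in \<open>T\<close> swaps the \<open>T\<close>-components of the row and the
  column multi-index.\<close>

definition partial_transpose ::
    "('n \<Rightarrow> 's::finite \<Rightarrow> nat) \<Rightarrow> 's set \<Rightarrow> complex^'n^'n \<Rightarrow> complex^'n^'n" where
  "partial_transpose e T A =
     (\<chi> k l. A $ inv e (\<lambda>i. if i \<in> T then e l i else e k i)
               $ inv e (\<lambda>i. if i \<in> T then e k i else e l i))"

definition PPT_states :: "('n \<Rightarrow> 's::finite \<Rightarrow> nat) \<Rightarrow> (complex^'n^'n) set" where
  "PPT_states e = {\<rho> \<in> states. \<forall>T. psd (partial_transpose e T \<rho>)}"

definition state_boundary :: "(complex^'n^'n) set \<Rightarrow> (complex^'n^'n) set" where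
  "state_boundary D = top_of_set {A \<in> Herm. trace A = 1} frontier_of D"


definition adj :: "complex^'n^'n \<Rightarrow> complex^'n^'n" where
  "adj A = (\<chi> k l. cnj (A $ l $ k))"

definition unitary :: "complex^'n^'n \<Rightarrow> bool" where
  "unitary U \<longleftrightarrow> adj U ** U = mat 1 \<and> U ** adj U = mat 1"

definition diag_mat :: "('n \<Rightarrow> real) \<Rightarrow> complex^'n^'n" where
  "diag_mat a = (\<chi> k l. if k = l then complex_of_real (a k) else 0)"

text \<open>Functional calculus for Hermitian \<open>A\<close>; the value does not depend on the diagonalization.\<close>

definition mat_fun :: "(real \<Rightarrow> real) \<Rightarrow> complex^'n^'n \<Rightarrow> complex^'n^'n" where
  "mat_fun f A = (THE B. \<exists>U a. unitary U \<and> A = U ** diag_mat a ** adj U \<and>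
                               B = U ** diag_mat (\<lambda>k. f (a k)) ** adj U)"

text \<open>Because \<open>ln 0 = 0\<close> in HOL, on positive semidefinite matrices \<open>mat_log\<close> is the logarithm on
  the support and zero on the kernel. In \<open>rel_entropy\<close> this amounts to the convention
  \<open>0 log 0 = 0\<close>.\<close>

definition mat_log :: "complex^'n^'n \<Rightarrow> complex^'n^'n" where
  "mat_log = mat_fun ln"

definition kernel :: "complex^'n^'n \<Rightarrow> (complex^'n) set" where
  "kernel A = {v. A *v v = 0}"

definition rel_entropy :: "complex^'n^'n \<Rightarrow> complex^'n^'n \<Rightarrow> ereal" where
  "rel_entropy \<rho> \<sigma> =
     (if kernel \<sigma> \<subseteq> kernel \<rho>
      then ereal (Re (trace (\<rho> ** mat_log \<rho> - \<rho> ** mat_log \<sigma>)))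
      else \<infinity>)"

definition rel_entropy_ent :: "(complex^'n^'n) set \<Rightarrow> complex^'n^'n \<Rightarrow> ereal" where
  "rel_entropy_ent D \<rho> = (INF \<sigma>\<in>D. rel_entropy \<rho> \<sigma>)"

definition is_CSS :: "(complex^'n^'n) set \<Rightarrow> complex^'n^'n \<Rightarrow> complex^'n^'n \<Rightarrow> bool" where
  "is_CSS D \<rho> \<sigma> \<longleftrightarrow> \<sigma> \<in> D \<and> rel_entropy_ent D \<rho> = rel_entropy \<rho> \<sigma>"

text \<open>\<open>L_op \<sigma> \<beta>\<close> is the first-order coefficient in
  \<open>log (\<sigma> + t\<beta>) = log \<sigma> + t L\<^sub>\<sigma>(\<beta>) + O(t\<^sup>2)\<close>, for positive definite \<open>\<sigma>\<close> and Hermitian \<open>\<beta>\<close>.\<close>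

definition L_op :: "complex^'n^'n \<Rightarrow> complex^'n^'n \<Rightarrow> complex^'n^'n" where
  "L_op \<sigma> \<beta> = vector_derivative (\<lambda>t::real. mat_log (\<sigma> + t *\<^sub>R \<beta>)) (at 0)"

definition L_inv :: "complex^'n^'n \<Rightarrow> complex^'n^'n \<Rightarrow> complex^'n^'n" where
  "L_inv \<sigma> = inv_into Herm (L_op \<sigma>)"

definition x_max :: "complex^'n^'n \<Rightarrow> complex^'n^'n \<Rightarrow> real" where
  "x_max \<sigma> \<phi> = (THE x. 0 < x \<and> \<sigma> - x *\<^sub>R L_inv \<sigma> \<phi> \<in> states \<and>
                       (\<exists>v. v \<noteq> 0 \<and> (\<sigma> - x *\<^sub>R L_inv \<sigma> \<phi>) *v v = 0))"

end

theory Submission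
  imports Defs "HOL-Real_Asymp.Real_Asymp"
begin

text \<open>
  As a function of \<open>\<sigma>\<close>, the relative entropy is \<open>- Tr (\<rho> log \<sigma>)\<close> up to a constant, and the
  logarithm is operator concave with derivative \<open>L\<^sub>\<sigma>\<close>. So a positive definite \<open>\<sigma>\<close> minimizes over the
  convex set \<open>D\<close> iff \<open>Tr (\<rho> L\<^sub>\<sigma>(\<sigma>' - \<sigma>)) \<le> 0\<close> for all \<open>\<sigma>' \<in> D\<close>. Since \<open>L\<^sub>\<sigma>\<close> is self-adjoint and
  \<open>L\<^sub>\<sigma>(\<sigma>) = 1\<close>, this says that \<open>1 - L\<^sub>\<sigma>(\<rho>) = L\<^sub>\<sigma>(\<sigma> - \<rho>)\<close> is a positive multiple \<open>x \<phi>\<close> of a normalized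
  functional supporting \<open>D\<close> at \<open>\<sigma>\<close>. Uniqueness for full-rank \<open>\<rho>\<close> is strict concavity.

  Everything is phrased with the real inner product \<open>A \<bullet> B = Re Tr (A\<^sup>* B)\<close> on matrices and
  \<open>v \<bullet> w = Re (v\<^sup>* w)\<close> on vectors that the type \<open>complex^'n\<close> carries in the library.
\<close>

section \<open>Hermitian matrices and the spectral theorem\<close>

text \<open>One scalar function of the shift supplies all the analysis. Its derivative is a
  quadratic form built from three resolvent factors. Nonnegativity of that form gives the tangent
  inequality, positivity at shift 0 gives strictness, and its decay like (c + s)^-3 gives a
  quadratic lower bound for the gap. The two-sided bound is what makes the divided-difference
  formula the actual derivative of \<open>mat_log\<close>, since \<open>L_op\<close> is defined as a
  derivative and not by that formula. The main obstacle is singular matrices: competitors \<sigma>'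
  in \<open>D\<close> and limits of minimizing sequences may have a kernel, where the relative
  entropy can jump to infinity. So the tangent inequality is proved between positive definite
  matrices and carried to the singular ones by limits. A second obstacle is that
  \<open>mat_fun\<close> and \<open>x_max\<close> are definite descriptions and \<open>L_inv\<close>
  is a chosen preimage, so each needs its own proof that the described object exists and is
  unique.\<close>

lemma adj_nth [simp]: "adj A $ k $ l = cnj (A $ l $ k)"
  by (simp add: adj_def)

lemma adj_adj [simp]: "adj (adj A) = A"
  by (simp add: vec_eq_iff)

lemma adj_mult: "adj (A ** B) = adj B ** adj A"
  by (simp add: vec_eq_iff matrix_matrix_mult_def mult.commute)

lemma adj_mat_1 [simp]: "adj (mat 1) = mat 1"
  by (simp add: vec_eq_iff mat_def)

lemma adj_add: "adj (A + B) = adj A + adj B"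
  and adj_diff: "adj (A - B) = adj A - adj B"
  and adj_scaleR: "adj (c *\<^sub>R A) = c *\<^sub>R adj A"
  by (simp_all add: vec_eq_iff)

lemma Herm_iff_adj: "A \<in> Herm \<longleftrightarrow> adj A = A"
proof -
  have "A \<in> Herm \<longleftrightarrow> (\<forall>k l. A $ k $ l = adj A $ k $ l)"
    by (simp add: Herm_def hermitian_on_def)
  also have "\<dots> \<longleftrightarrow> adj A = A" unfolding vec_eq_iff by metis
  finally show ?thesis .
qed

lemma Herm_add: "A \<in> Herm \<Longrightarrow> B \<in> Herm \<Longrightarrow> A + B \<in> Herm"
  and Herm_diff: "A \<in> Herm \<Longrightarrow> B \<in> Herm \<Longrightarrow> A - B \<in> Herm"
  and Herm_scaleR: "A \<in> Herm \<Longrightarrow> c *\<^sub>R A \<in> Herm"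
  and Herm_mat_1: "mat 1 \<in> Herm"
  by (simp_all add: Herm_iff_adj adj_add adj_diff adj_scaleR)

lemma Herm_conj: "A \<in> Herm \<Longrightarrow> U ** A ** adj U \<in> Herm"
  by (simp add: Herm_iff_adj adj_mult matrix_mul_assoc)

lemma matrix_mul_scaleR_left: "(c *\<^sub>R A) ** B = c *\<^sub>R (A ** B :: complex^'n^'n)"
  by (simp add: matrix_matrix_mult_def vec_eq_iff scaleR_sum_right)

lemma matrix_mul_scaleR_right: "A ** (c *\<^sub>R B) = c *\<^sub>R (A ** B :: complex^'n^'n)"
  by (simp add: matrix_matrix_mult_def vec_eq_iff scaleR_sum_right)

lemma matrix_vector_mul_scaleR_left: "(c *\<^sub>R A) *v x = c *\<^sub>R (A *v x :: complex^'n)"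
  by (simp add: matrix_vector_mult_def vec_eq_iff scaleR_sum_right)

lemma matrix_vector_mul_scaleR_right: "A *v (c *\<^sub>R x) = c *\<^sub>R (A *v x :: complex^'n)"
  by (simp add: matrix_vector_mult_def vec_eq_iff scaleR_sum_right)

lemma trace_scaleR: "trace (c *\<^sub>R A :: complex^'n^'n) = c *\<^sub>R trace A"
  by (simp add: trace_def scaleR_sum_right)

section \<open>Traces and quadratic forms as real inner products\<close>

lemma inner_complex_cnj: "(x::complex) \<bullet> y = Re (cnj x * y)"
  by (simp add: inner_complex_def)

lemma inner_matrix_trace: "(A :: complex^'n^'n) \<bullet> B = Re (trace (adj A ** B))"
proof -
  have "A \<bullet> B = (\<Sum>k\<in>UNIV. \<Sum>l\<in>UNIV. Re (cnj (A $ k $ l) * B $ k $ l))"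
    unfolding inner_vec_def inner_complex_cnj ..
  also have "\<dots> = (\<Sum>l\<in>UNIV. \<Sum>k\<in>UNIV. Re (cnj (A $ k $ l) * B $ k $ l))"
    by (rule sum.swap)
  also have "\<dots> = Re (trace (adj A ** B))"
    unfolding trace_def matrix_matrix_mult_def Re_sum by simp
  finally show ?thesis .
qed

lemma inner_mult_left: "(A ** B :: complex^'n^'n) \<bullet> C = B \<bullet> (adj A ** C)"
  by (simp add: inner_matrix_trace adj_mult matrix_mul_assoc)

lemma inner_mult_right: "(A ** B :: complex^'n^'n) \<bullet> C = A \<bullet> (C ** adj B)"
  unfolding inner_matrix_trace adj_mult
  by (metis matrix_mul_assoc trace_mul_sym)

lemma inner_mult_vector: "(x :: complex^'n) \<bullet> (A *v y) = (adj A *v x) \<bullet> y"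
proof -
  have "x \<bullet> (A *v y) = (\<Sum>k\<in>UNIV. \<Sum>l\<in>UNIV. Re (cnj (x $ k) * (A $ k $ l * y $ l)))"
    unfolding inner_vec_def inner_complex_cnj matrix_vector_mult_def
    by (simp only: vec_lambda_beta sum_distrib_left Re_sum)
  also have "\<dots> = (\<Sum>l\<in>UNIV. \<Sum>k\<in>UNIV. Re (cnj (x $ k) * (A $ k $ l * y $ l)))"
    by (rule sum.swap)
  also have "\<dots> = (\<Sum>l\<in>UNIV. \<Sum>k\<in>UNIV. Re (cnj (adj A $ l $ k * x $ k) * y $ l))"
    by (intro sum.cong refl arg_cong[of _ _ Re]) simp
  also have "\<dots> = (adj A *v x) \<bullet> y"
    unfolding inner_vec_def inner_complex_cnj matrix_vector_mult_def
    by (simp only: vec_lambda_beta sum_distrib_right Re_sum cnj_sum)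
  finally show ?thesis .
qed

lemma inner_Herm_vector: "A \<in> Herm \<Longrightarrow> (x :: complex^'n) \<bullet> (A *v y) = (A *v x) \<bullet> y"
  using inner_mult_vector[of x A y] by (simp add: Herm_iff_adj)

lemma trace_mult_Herm: "A \<in> Herm \<Longrightarrow> Re (trace (A ** B)) = A \<bullet> B"
  by (simp add: inner_matrix_trace Herm_iff_adj)

lemma trace_mult_Herm_real:
  assumes "A \<in> Herm" "B \<in> Herm"
  shows "trace (A ** B) = of_real (A \<bullet> B)"
proof -
  have adj_trace: "trace (adj X) = cnj (trace X)" for X :: "complex^'n^'n"
    by (simp add: trace_def)
  have "cnj (trace (A ** B)) = trace (A ** B)"
    using assms trace_mul_sym[of A B] unfolding adj_trace[symmetric] adj_mult Herm_iff_adj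
    by simp
  hence "Im (trace (A ** B)) = 0"
    by (simp add: complex_eq_iff)
  thus ?thesis
    using trace_mult_Herm[OF assms(1), of B] by (simp add: complex_eq_iff)
qed

lemma quad_form_inner: "Re (quad_form_on UNIV (entries A) (($) v)) = v \<bullet> (A *v v)"
  unfolding quad_form_on_def inner_vec_def matrix_vector_mult_def inner_complex_cnj
  by (simp only: vec_lambda_beta sum_distrib_left Re_sum mult.assoc)

lemma quad_form_inner': "Re (quad_form_on UNIV (entries A) w) = (\<chi> k. w k) \<bullet> (A *v (\<chi> k. w k))"
proof -
  have "(($) (\<chi> k. w k)) = w" by (simp add: fun_eq_iff)
  thus ?thesis using quad_form_inner[of A "\<chi> k. w k"] by simp
qed

lemma psd_iff: "psd A \<longleftrightarrow> A \<in> Herm \<and> (\<forall>v. 0 \<le> v \<bullet> (A *v v))"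
proof -
  have "(\<forall>w. 0 \<le> Re (quad_form_on UNIV (entries A) w)) \<longleftrightarrow> (\<forall>v. 0 \<le> v \<bullet> (A *v v))"
    using quad_form_inner[of A] quad_form_inner'[of A] by metis
  thus ?thesis by (simp add: psd_def psd_on_def Herm_def)
qed

lemma pos_def_iff: "pos_def A \<longleftrightarrow> A \<in> Herm \<and> (\<forall>v. v \<noteq> 0 \<longrightarrow> 0 < v \<bullet> (A *v v))"
proof -
  have 1: "(($) v = (\<lambda>_. 0)) \<longleftrightarrow> v = 0" for v :: "complex^'n"
    by (auto simp: vec_eq_iff fun_eq_iff)
  have 2: "((\<chi> k. w k) = (0::complex^'n)) \<longleftrightarrow> w = (\<lambda>_. 0)" for w
    by (auto simp: vec_eq_iff fun_eq_iff)
  show ?thesis unfolding pos_def_def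
    by (metis 1 2 quad_form_inner quad_form_inner')
qed

lemma pos_def_Herm: "pos_def A \<Longrightarrow> A \<in> Herm"
  and psd_Herm: "psd A \<Longrightarrow> A \<in> Herm"
  by (auto simp: pos_def_def psd_iff)

lemma pos_def_kernel: "pos_def A \<Longrightarrow> kernel A = {0}"
  by (auto simp: pos_def_iff kernel_def matrix_vector_mult_0_right)

section \<open>Diagonalization of Hermitian matrices\<close>

definition spectral :: "complex^'n^'n \<Rightarrow> ('n \<Rightarrow> real) \<Rightarrow> complex^'n^'n" where
  "spectral U a = U ** diag_mat a ** adj U"

text \<open>A maximizer \<open>v\<close> of the Rayleigh quotient on the unit sphere of
  \<open>W\<close> is an eigenvector: \<open>Q\<close> is nonnegative on \<open>W\<close> and
  vanishes at \<open>v\<close>, so its first variation in the direction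
  \<open>y = c *\<^sub>R v - A *v v\<close> must vanish, and that variation is a multiple of
  \<open>y \<bullet> y\<close>. Since \<open>W\<close> is only required to be a real subspace, real
  variations and the real inner product suffice.\<close>

lemma Herm_exists_eigenvector:
  fixes A :: "complex^'n^'n" and W :: "(complex^'n) set"
  assumes A: "A \<in> Herm" and W: "subspace W" and inv: "\<And>w. w \<in> W \<Longrightarrow> A *v w \<in> W" and "W \<noteq> {0}"
  obtains v c where "v \<in> W" "norm v = 1" "A *v v = c *\<^sub>R v"
proof -
  obtain w0 where w0: "w0 \<in> W" "w0 \<noteq> 0" using assms(4) subspace_0[OF W] by auto
  let ?S = "W \<inter> sphere 0 1"
  have "closed W" by (rule closed_subspace[OF W])
  hence "compact ?S" using compact_Int_closed[of "sphere 0 1" W] by (simp add: Int_commute)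
  moreover have "(1 / norm w0) *\<^sub>R w0 \<in> ?S" using w0 W by (simp add: subspace_scale)
  moreover have "continuous_on ?S (\<lambda>v. v \<bullet> (A *v v))"
    by (intro continuous_intros)
  ultimately obtain v where v: "v \<in> ?S" and max: "\<And>w. w \<in> ?S \<Longrightarrow> w \<bullet> (A *v w) \<le> v \<bullet> (A *v v)"
    using continuous_attains_sup[of ?S "\<lambda>v. v \<bullet> (A *v v)"] by blast
  define c where "c = v \<bullet> (A *v v)"
  define Q where "Q = (\<lambda>w. c * (w \<bullet> w) - w \<bullet> (A *v w))"
  have Q: "0 \<le> Q w" if "w \<in> W" for w
  proof (cases "w = 0")
    case False
    have "((1 / norm w) *\<^sub>R w) \<bullet> (A *v ((1 / norm w) *\<^sub>R w)) \<le> c"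
      unfolding c_def using False W that by (intro max) (simp add: subspace_scale)
    thus ?thesis using False
      by (simp add: Q_def matrix_vector_mul_scaleR_right field_simps power2_norm_eq_inner[symmetric] power2_eq_square)
  qed (simp add: Q_def)
  have vW: "v \<in> W" and nv: "norm v = 1" using v by auto
  define y where "y = c *\<^sub>R v - A *v v"
  have yW: "y \<in> W" unfolding y_def using W vW inv by (simp add: subspace_diff subspace_scale)
  have exp: "Q (v + t *\<^sub>R y) = 2 * t * (y \<bullet> y) + t\<^sup>2 * Q y" for t
  proof -
    have s: "v \<bullet> (A *v y) = y \<bullet> (A *v v)"
      using inner_Herm_vector[OF A, of v y] by (simp add: inner_commute)
    have vv: "v \<bullet> v = 1" using nv by (simp add: norm_eq_1)
    have y': "c * (v \<bullet> y) - y \<bullet> (A *v v) = y \<bullet> y"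
      by (subst (3) y_def) (simp add: inner_diff_right inner_commute)
    have "Q (v + t *\<^sub>R y) = 2 * t * (c * (v \<bullet> y) - y \<bullet> (A *v v)) + t\<^sup>2 * Q y"
      unfolding Q_def
      by (simp add: s vv matrix_vector_right_distrib matrix_vector_mul_scaleR_right inner_add_left
        inner_add_right algebra_simps power2_eq_square c_def inner_commute[of y v])
    thus ?thesis by (simp add: y')
  qed
  have "y \<bullet> y = 0"
  proof (rule ccontr)
    assume "y \<bullet> y \<noteq> 0"
    hence p: "0 < y \<bullet> y" by simp
    have q: "0 \<le> Q y" by (rule Q[OF yW])
    \<comment> \<open>A negative step so short that the quadratic term cannot outweigh the linear
      one; the summand 1 keeps the denominator positive when \<open>Q y\<close> is 0.\<close>
    define t where "t = - ((y \<bullet> y) / (Q y + 1))"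
    have "0 \<le> Q (v + t *\<^sub>R y)" using vW yW W by (intro Q) (simp add: subspace_add subspace_scale)
    hence "0 \<le> t * (2 * (y \<bullet> y) + t * Q y)" by (simp add: exp power2_eq_square algebra_simps)
    moreover have "t < 0" using p q by (simp add: t_def)
    ultimately have "2 * (y \<bullet> y) + t * Q y \<le> 0" by (simp add: zero_le_mult_iff)
    moreover have "- (t * Q y) \<le> y \<bullet> y" using p q by (simp add: t_def field_simps)
    ultimately show False using p by simp
  qed
  hence "A *v v = c *\<^sub>R v" by (simp add: y_def)
  thus thesis using that vW nv by blast
qed

text \<open>The induction adds one index at a time, taking the new eigenvector in the complex
  orthogonal complement of the earlier ones. The real inner product sees only real parts, so the
  complement is encoded as the kernel of a matrix \<open>M\<close> with rows conjugate to the
  \<open>u i\<close>.\<close>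

lemma orthonormal_eigenvectors:
  fixes A :: "complex^'n^'n"
  assumes A: "A \<in> Herm" and "finite I"
  shows "\<exists>(u :: 'n \<Rightarrow> complex^'n) a. (\<forall>i\<in>I. A *v u i = a i *\<^sub>R u i) \<and>
    (\<forall>i\<in>I. \<forall>j\<in>I. (\<Sum>k\<in>UNIV. cnj (u i $ k) * u j $ k) = (if i = j then 1 else 0))"
  using \<open>finite I\<close>
proof induction
  case empty
  show ?case by simp
next
  case (insert j I)
  then obtain u :: "'n \<Rightarrow> complex^'n" and a where
    eig: "\<And>i. i \<in> I \<Longrightarrow> A *v u i = a i *\<^sub>R u i" and
    on: "\<And>i j. i \<in> I \<Longrightarrow> j \<in> I \<Longrightarrow> (\<Sum>k\<in>UNIV. cnj (u i $ k) * u j $ k) = (if i = j then 1 else 0)"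
    by blast
  define M :: "complex^'n^'n" where "M = (\<chi> i k. if i \<in> I then cnj (u i $ k) else 0)"
  define W where "W = {w. M *v w = 0}"
  have W: "subspace W" unfolding W_def
    by (auto simp: subspace_def matrix_vector_right_distrib matrix_vector_mul_scaleR_right)
  have memW: "w \<in> W \<longleftrightarrow> (\<forall>i\<in>I. (\<Sum>k\<in>UNIV. cnj (u i $ k) * w $ k) = 0)" for w
  proof -
    have "(M *v w) $ i = (if i \<in> I then \<Sum>k\<in>UNIV. cnj (u i $ k) * w $ k else 0)" for i
      by (simp add: M_def matrix_vector_mult_def)
    thus ?thesis by (simp add: W_def vec_eq_iff Ball_def)
  qed
  have ne: "W \<noteq> {0}"
  proof
    assume "W = {0}"
    hence "\<exists>B. B ** M = mat 1" unfolding matrix_left_invertible_ker W_def by auto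
    then obtain B where "M ** B = mat 1" using matrix_left_right_inverse by blast
    \<comment> \<open>Row \<open>j\<close> of \<open>M\<close> is zero because \<open>j\<close> is a
      fresh index, so \<open>M\<close> cannot be invertible. This replaces a dimension
      count.\<close>
    hence "(M ** B) $ j $ j = (1::complex)" by (simp add: mat_def)
    thus False using insert.hyps(2) by (simp add: matrix_matrix_mult_def M_def)
  qed
  have inv: "A *v w \<in> W" if w: "w \<in> W" for w
  proof -
    have "(\<Sum>k\<in>UNIV. cnj (u i $ k) * (A *v w) $ k) = 0" if i: "i \<in> I" for i
    proof -
      have "(\<Sum>k\<in>UNIV. cnj (u i $ k) * (A *v w) $ k) = (\<Sum>l\<in>UNIV. \<Sum>k\<in>UNIV. cnj (u i $ k) * A $ k $ l * w $ l)"
        unfolding matrix_vector_mult_def by (simp add: sum_distrib_left mult.assoc) (rule sum.swap)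
      also have "\<dots> = (\<Sum>l\<in>UNIV. cnj ((A *v u i) $ l) * w $ l)"
      proof (intro sum.cong refl)
        fix l
        have h: "cnj (A $ l $ k) = A $ k $ l" for k
          using A unfolding Herm_iff_adj by (metis adj_nth)
        show "(\<Sum>k\<in>UNIV. cnj (u i $ k) * A $ k $ l * w $ l) = cnj ((A *v u i) $ l) * w $ l"
          by (simp add: matrix_vector_mult_def sum_distrib_left sum_distrib_right h mult_ac)
      qed
      also have "\<dots> = a i *\<^sub>R (\<Sum>l\<in>UNIV. cnj (u i $ l) * w $ l)"
        by (simp add: eig[OF i] scaleR_sum_right)
      finally show ?thesis using w i by (simp add: memW)
    qed
    thus ?thesis by (simp add: memW)
  qed
  obtain v c where v: "v \<in> W" "norm v = 1" "A *v v = c *\<^sub>R v"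
    using Herm_exists_eigenvector[OF A W inv ne] by blast
  have vI: "(\<Sum>k\<in>UNIV. cnj (u i $ k) * v $ k) = 0" if "i \<in> I" for i
    using v(1) that by (simp add: memW)
  have vI': "(\<Sum>k\<in>UNIV. cnj (v $ k) * u i $ k) = 0" if "i \<in> I" for i
    using arg_cong[OF vI[OF that], of cnj] by (simp add: mult.commute)
  have vv: "(\<Sum>k\<in>UNIV. cnj (v $ k) * v $ k) = 1"
  proof -
    have "(\<Sum>k\<in>UNIV. cnj (v $ k) * v $ k) = of_real (\<Sum>k\<in>UNIV. (cmod (v $ k))\<^sup>2)"
      by (simp add: mult.commute complex_norm_square[symmetric] del: of_real_power)
    also have "(\<Sum>k\<in>UNIV. (cmod (v $ k))\<^sup>2) = 1"
      using v(2) by (simp add: norm_vec_def L2_set_def)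
    finally show ?thesis by simp
  qed
  show ?case
    by (rule exI[of _ "u(j := v)"], rule exI[of _ "a(j := c)"])
      (use insert.hyps(2) eig on v(3) vI vI' vv in auto)
qed

lemma diag_mat_mult_right: "(U ** diag_mat a) $ k $ l = a l *\<^sub>R U $ k $ l"
  by (simp add: matrix_matrix_mult_def diag_mat_def if_distrib[of "\<lambda>x. _ * x"] scaleR_conv_of_real
      mult.commute cong: if_cong)

lemma diag_mat_mult_left: "(diag_mat a ** U) $ k $ l = a k *\<^sub>R U $ k $ l"
  by (simp add: matrix_matrix_mult_def diag_mat_def if_distrib[of "\<lambda>x. x * _"] scaleR_conv_of_real
      cong: if_cong)

lemma diag_mat_mult: "diag_mat a ** diag_mat b = diag_mat (\<lambda>k. a k * b k)"
  unfolding vec_eq_iff diag_mat_mult_left by (simp add: diag_mat_def scaleR_conv_of_real)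

theorem Herm_spectral:
  fixes A :: "complex^'n^'n"
  assumes "A \<in> Herm"
  obtains U a where "unitary U" "A = spectral U a"
proof -
  obtain u :: "'n \<Rightarrow> complex^'n" and a where eig: "\<And>i. A *v u i = a i *\<^sub>R u i" and
    on: "\<And>i j. (\<Sum>k\<in>UNIV. cnj (u i $ k) * u j $ k) = (if i = j then 1 else 0)"
    using orthonormal_eigenvectors[OF assms, of UNIV] by auto
  define U :: "complex^'n^'n" where "U = (\<chi> k i. u i $ k)"
  have U1: "adj U ** U = mat 1"
    by (simp add: vec_eq_iff matrix_matrix_mult_def mat_def U_def on)
  have U2: "U ** adj U = mat 1" using U1 matrix_left_right_inverse by blast
  have "A ** U = U ** diag_mat a"
    using eig unfolding vec_eq_iff diag_mat_mult_right
    by (simp add: U_def matrix_matrix_mult_def matrix_vector_mult_def)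
  hence "A = U ** diag_mat a ** adj U"
    by (metis U2 matrix_mul_assoc matrix_mul_rid)
  thus thesis using U1 U2 that by (simp add: unitary_def spectral_def)
qed

section \<open>Functional calculus and Hadamard multipliers in an eigenbasis\<close>

lemma matrix_mul_add_left: "(A + B) ** C = A ** C + B ** (C :: complex^'n^'n)"
  by (simp add: matrix_matrix_mult_def vec_eq_iff sum.distrib algebra_simps)

lemma unitary_adj_mult: "unitary U \<Longrightarrow> adj U ** U = mat 1"
  and unitary_mult_adj: "unitary U \<Longrightarrow> U ** adj U = mat 1"
  by (simp_all add: unitary_def)

lemma unitary_cancel_left: "unitary U \<Longrightarrow> adj U ** (U ** A) = A"
  and unitary_cancel_left': "unitary U \<Longrightarrow> U ** (adj U ** A) = A"
  by (simp_all add: matrix_mul_assoc unitary_def)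

lemma diag_mat_const: "diag_mat (\<lambda>_. c) = c *\<^sub>R mat 1"
  by (simp add: vec_eq_iff diag_mat_def mat_def of_real_def)

lemma diag_mat_add: "diag_mat (\<lambda>k. a k + b k) = diag_mat a + diag_mat b"
  by (simp add: vec_eq_iff diag_mat_def)

lemma adj_diag_mat [simp]: "adj (diag_mat a) = diag_mat a"
  by (auto simp: vec_eq_iff diag_mat_def)

lemma spectral_Herm: "spectral U a \<in> Herm"
  by (simp add: spectral_def Herm_conj Herm_iff_adj[of "diag_mat a"])

lemma spectral_const: "unitary U \<Longrightarrow> spectral U (\<lambda>_. c) = c *\<^sub>R mat 1"
  by (simp add: spectral_def diag_mat_const matrix_mul_scaleR_left matrix_mul_scaleR_right
      unitary_mult_adj)

lemma spectral_add: "spectral U (\<lambda>k. a k + b k) = spectral U a + spectral U b"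
  by (simp add: spectral_def diag_mat_add matrix_add_ldistrib matrix_mul_add_left)

lemma spectral_shift: "unitary U \<Longrightarrow> spectral U (\<lambda>k. a k + s) = spectral U a + s *\<^sub>R mat 1"
  by (simp add: spectral_add spectral_const)

lemma spectral_mult:
  assumes "unitary U"
  shows "spectral U a ** spectral U b = spectral U (\<lambda>k. a k * b k)"
  unfolding spectral_def diag_mat_mult[symmetric] matrix_mul_assoc[symmetric]
    unitary_cancel_left[OF assms] ..

lemma spectral_inverse:
  assumes "unitary U" "\<And>k. a k \<noteq> 0"
  shows "spectral U a ** spectral U (\<lambda>k. 1 / a k) = mat 1"
    and "spectral U (\<lambda>k. 1 / a k) ** spectral U a = mat 1"
  using assms by (simp_all add: spectral_mult spectral_const)

lemma diag_mat_mult_vector: "(diag_mat a *v x) $ k = a k *\<^sub>R x $ k"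
  by (simp add: matrix_vector_mult_def diag_mat_def if_distrib[of "\<lambda>x. x * _"] scaleR_conv_of_real
      cong: if_cong)

lemma spectral_quad_form:
  "v \<bullet> (spectral U a *v v) = (\<Sum>k\<in>UNIV. a k * (cmod ((adj U *v v) $ k))\<^sup>2)"
proof -
  have "v \<bullet> (spectral U a *v v) = (adj U *v v) \<bullet> (diag_mat a *v (adj U *v v))"
    by (simp add: spectral_def inner_mult_vector matrix_vector_mul_assoc[symmetric])
  thus ?thesis
    by (simp add: inner_vec_def[of "adj U *v v"] diag_mat_mult_vector dot_square_norm)
qed

lemma unitary_norm_coords:
  assumes "unitary U"
  shows "(\<Sum>k\<in>UNIV. (cmod ((adj U *v v) $ k))\<^sup>2) = v \<bullet> v"
  using spectral_quad_form[of v U "\<lambda>_. 1"] by (simp add: spectral_const assms)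

lemma mult_axis_column: "U *v axis k 1 = (column k U :: complex^'n)"
  by (simp add: vec_eq_iff matrix_vector_mult_def axis_def column_def if_distrib[of "\<lambda>x. _ * x"]
      cong: if_cong)

lemma conj_diag_quad_form: "Re ((adj U ** A ** U) $ k $ k) = column k U \<bullet> (A *v column k U)"
proof -
  have "axis k 1 \<bullet> ((adj U ** A ** U) *v axis k 1) = column k U \<bullet> (A *v column k U)"
    unfolding matrix_vector_mul_assoc[symmetric] inner_mult_vector[of "axis k 1" "adj U"] adj_adj
    unfolding mult_axis_column ..
  thus ?thesis
    by (simp add: mult_axis_column inner_axis inner_commute[of "axis k 1"] column_def)
qed

text \<open>Moving the conjugation by \<open>U\<close> to the other factor leaves a pairing with a
  diagonal matrix, which sees only diagonal entries. With weights \<open>ln (a k)\<close> this turns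
  \<rho> \<bullet> log into a finite scalar sum.\<close>

lemma inner_spectral:
  "A \<bullet> spectral U a = (\<Sum>k\<in>UNIV. a k * (column k U \<bullet> (A *v column k U)))"
proof -
  have "A \<bullet> spectral U a = diag_mat a \<bullet> (adj U ** A ** U)"
    using inner_mult_right[of "U ** diag_mat a" "adj U" A] inner_mult_left[of U "diag_mat a" "A ** U"]
    by (simp add: spectral_def inner_commute[of A] matrix_mul_assoc)
  also have "\<dots> = (\<Sum>k\<in>UNIV. \<Sum>l\<in>UNIV. if k = l then a k * Re ((adj U ** A ** U) $ k $ l) else 0)"
    unfolding inner_vec_def diag_mat_def
    by (intro sum.cong refl) (simp add: inner_complex_def)
  finally show ?thesis by (simp add: conj_diag_quad_form)
qed

lemma column_spectral_quad_form:
  assumes "unitary U"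
  shows "column k U \<bullet> (spectral U a *v column k U) = a k"
  by (simp add: conj_diag_quad_form[symmetric] spectral_def matrix_mul_assoc unitary_adj_mult[OF assms])
     (simp add: matrix_mul_assoc[symmetric] unitary_adj_mult[OF assms] diag_mat_def)

lemma column_unitary_nonzero:
  assumes "unitary U"
  shows "column k U \<noteq> 0"
  using column_spectral_quad_form[OF assms, of k "\<lambda>_. 1"] by auto

lemma psd_spectral:
  assumes "unitary U"
  shows "psd (spectral U a) \<longleftrightarrow> (\<forall>k. 0 \<le> a k)"
proof
  assume "psd (spectral U a)"
  thus "\<forall>k. 0 \<le> a k"
    using column_spectral_quad_form[OF assms] by (metis psd_iff)
next
  assume "\<forall>k. 0 \<le> a k"
  thus "psd (spectral U a)" by (simp add: psd_iff spectral_Herm spectral_quad_form sum_nonneg)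
qed

lemma spectral_quad_form_ge:
  assumes "unitary U" "\<And>k. c \<le> a k"
  shows "c * (v \<bullet> v) \<le> v \<bullet> (spectral U a *v v)"
  unfolding spectral_quad_form unitary_norm_coords[OF assms(1), of v, symmetric] sum_distrib_left
  by (intro sum_mono mult_right_mono assms) simp

lemma spectral_quad_form_le:
  assumes "unitary U" "\<And>k. a k \<le> c"
  shows "v \<bullet> (spectral U a *v v) \<le> c * (v \<bullet> v)"
  unfolding spectral_quad_form unitary_norm_coords[OF assms(1), of v, symmetric] sum_distrib_left
  by (intro sum_mono mult_right_mono assms) simp

lemma pos_def_spectral:
  assumes "unitary U"
  shows "pos_def (spectral U a) \<longleftrightarrow> (\<forall>k. 0 < a k)"
proof
  assume "pos_def (spectral U a)"
  thus "\<forall>k. 0 < a k"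
    using column_spectral_quad_form[OF assms] column_unitary_nonzero[OF assms] by (metis pos_def_iff)
next
  assume a: "\<forall>k. 0 < a k"
  define c where "c = Min (range a)"
  have "0 < c" "\<And>k. c \<le> a k" using a by (auto simp: c_def)
  hence "0 < v \<bullet> (spectral U a *v v)" if "v \<noteq> 0" for v
    using spectral_quad_form_ge[OF assms, of c a v] that
    by (metis inner_gt_zero_iff less_le_trans mult_pos_pos)
  thus "pos_def (spectral U a)" by (simp add: pos_def_iff spectral_Herm)
qed

lemma pos_def_obtain_spectral:
  assumes "pos_def A"
  obtains U a where "unitary U" "A = spectral U a" "\<And>k. 0 < a k"
  using assms Herm_spectral pos_def_Herm pos_def_spectral by metis

lemma psd_obtain_spectral:
  assumes "psd A"
  obtains U a where "unitary U" "A = spectral U a" "\<And>k. 0 \<le> a k"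
  using assms Herm_spectral psd_Herm psd_spectral by metis

text \<open>Independence of the diagonalization: the transition matrix \<open>M\<close> between two
  eigenbases intertwines the two diagonal matrices. Entrywise, either \<open>M $ k $ l\<close> is
  zero or \<open>a l = b k\<close>, so \<open>f\<close> may be applied to both eigenvalues and
  \<open>M\<close> still intertwines.\<close>

lemma mat_fun_spectral:
  assumes U: "unitary U"
  shows "mat_fun f (spectral U a) = spectral U (\<lambda>k. f (a k))"
  unfolding mat_fun_def
proof (rule the_equality)
  show "\<exists>U' a'. unitary U' \<and> spectral U a = U' ** diag_mat a' ** adj U' \<and>
    spectral U (\<lambda>k. f (a k)) = U' ** diag_mat (\<lambda>k. f (a' k)) ** adj U'"
    using U by (auto simp: spectral_def)
next
  fix B
  assume "\<exists>V b. unitary V \<and> spectral U a = V ** diag_mat b ** adj V \<and>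
    B = V ** diag_mat (\<lambda>k. f (b k)) ** adj V"
  then obtain V b where V: "unitary V" and eq: "spectral U a = spectral V b"
    and B: "B = spectral V (\<lambda>k. f (b k))"
    by (auto simp: spectral_def)
  define M where "M = adj V ** U"
  have 1: "adj V ** spectral U x ** U = M ** diag_mat x" for x
    by (simp add: M_def spectral_def matrix_mul_assoc[symmetric] unitary_adj_mult[OF U])
  have 2: "adj V ** spectral V x ** U = diag_mat x ** M" for x
    by (simp add: M_def spectral_def matrix_mul_assoc unitary_adj_mult[OF V])
  have "M ** diag_mat a = diag_mat b ** M"
    using 1[of a] 2[of b] eq by simp
  hence "a l *\<^sub>R M $ k $ l = b k *\<^sub>R M $ k $ l" for k l
    by (metis diag_mat_mult_left diag_mat_mult_right)
  hence "f (a l) *\<^sub>R M $ k $ l = f (b k) *\<^sub>R M $ k $ l" for k l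
    by (metis scaleR_cancel_right)
  hence "M ** diag_mat (\<lambda>k. f (a k)) = diag_mat (\<lambda>k. f (b k)) ** M"
    by (simp add: vec_eq_iff diag_mat_mult_left diag_mat_mult_right)
  hence "adj V ** spectral U (\<lambda>k. f (a k)) ** U = adj V ** B ** U"
    by (simp add: 1 2 B)
  hence "V ** (adj V ** spectral U (\<lambda>k. f (a k)) ** U) ** adj U = V ** (adj V ** B ** U) ** adj U"
    by simp
  thus "B = spectral U (\<lambda>k. f (a k))"
    by (simp add: matrix_mul_assoc[symmetric] unitary_mult_adj[OF U] unitary_cancel_left'[OF V])
qed

lemma mat_log_spectral: "unitary U \<Longrightarrow> mat_log (spectral U a) = spectral U (\<lambda>k. ln (a k))"
  by (simp add: mat_log_def mat_fun_spectral)

lemma mat_log_Herm: "A \<in> Herm \<Longrightarrow> mat_log A \<in> Herm"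
  by (metis Herm_spectral mat_log_spectral spectral_Herm)

text \<open>A Schur multiplier in the basis given by \<open>U\<close>. With the divided differences
  of a function as symbol \<open>m\<close> it is the Daleckii-Krein form of the derivative of the
  functional calculus. Symbols multiply under composition, so inverses are read off
  entrywise.\<close>

definition hadamard :: "complex^'n^'n \<Rightarrow> ('n \<Rightarrow> 'n \<Rightarrow> real) \<Rightarrow> complex^'n^'n \<Rightarrow> complex^'n^'n" where
  "hadamard U m D = U ** (\<chi> k l. m k l *\<^sub>R (adj U ** D ** U) $ k $ l) ** adj U"

lemma hadamard_coords:
  assumes "unitary U"
  shows "adj U ** hadamard U m D ** U = (\<chi> k l. m k l *\<^sub>R (adj U ** D ** U) $ k $ l)"
  using assms
  by (simp add: hadamard_def matrix_mul_assoc[symmetric] unitary_cancel_left unitary_adj_mult)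

lemma hadamard_compose:
  assumes "unitary U"
  shows "hadamard U m (hadamard U m' D) = hadamard U (\<lambda>k l. m k l * m' k l) D"
  unfolding hadamard_def[of U m] hadamard_coords[OF assms] by (simp add: hadamard_def)

lemma hadamard_one:
  assumes "unitary U"
  shows "hadamard U (\<lambda>_ _. 1) D = D"
proof -
  have "hadamard U (\<lambda>_ _. 1) D = U ** (adj U ** D ** U) ** adj U"
    by (simp add: hadamard_def vec_lambda_eta)
  thus ?thesis using assms
    by (simp add: matrix_mul_assoc[symmetric] unitary_cancel_left' unitary_mult_adj)
qed

lemma hadamard_add: "hadamard U m (A + B) = hadamard U m A + hadamard U m B"
proof -
  have "(\<chi> k l. m k l *\<^sub>R (adj U ** (A + B) ** U) $ k $ l) =
    (\<chi> k l. m k l *\<^sub>R (adj U ** A ** U) $ k $ l) + (\<chi> k l. m k l *\<^sub>R (adj U ** B ** U) $ k $ l)"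
    by (simp add: vec_eq_iff matrix_add_ldistrib matrix_mul_add_left scaleR_add_right)
  thus ?thesis by (simp add: hadamard_def matrix_add_ldistrib matrix_mul_add_left)
qed

lemma hadamard_scaleR: "hadamard U m (c *\<^sub>R A) = c *\<^sub>R hadamard U m A"
proof -
  have "(\<chi> k l. m k l *\<^sub>R (adj U ** (c *\<^sub>R A) ** U) $ k $ l) =
    c *\<^sub>R (\<chi> k l. m k l *\<^sub>R (adj U ** A ** U) $ k $ l)"
    by (simp add: vec_eq_iff matrix_mul_scaleR_left matrix_mul_scaleR_right)
  thus ?thesis by (simp add: hadamard_def matrix_mul_scaleR_left matrix_mul_scaleR_right)
qed

lemma linear_hadamard: "linear (hadamard U m)"
  by (rule linearI) (simp_all add: hadamard_add hadamard_scaleR)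

lemma hadamard_Herm:
  assumes "D \<in> Herm" "\<And>k l. m k l = m l k"
  shows "hadamard U m D \<in> Herm"
proof -
  have "adj U ** D ** U \<in> Herm"
    using Herm_conj[OF assms(1), of "adj U"] by simp
  hence "(\<chi> k l. m k l *\<^sub>R (adj U ** D ** U) $ k $ l) \<in> Herm"
    unfolding Herm_iff_adj vec_eq_iff adj_nth vec_lambda_beta
    by (metis assms(2) complex_cnj_scaleR)
  thus ?thesis unfolding hadamard_def by (rule Herm_conj)
qed

lemma inner_conj: "A \<bullet> (U ** M ** adj U) = (adj U ** A ** U) \<bullet> M"
  using inner_mult_right[of "U ** M" "adj U" A] inner_mult_left[of U M "A ** U"]
  by (simp add: inner_commute[of A] inner_commute[of _ M] matrix_mul_assoc)

text \<open>In the coordinates given by \<open>U\<close> the pairing is entrywise, and a real factor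
  can be attached to either side. This is the source of the self-adjointness of L_\<sigma>.\<close>

lemma inner_hadamard: "A \<bullet> hadamard U m D = hadamard U m A \<bullet> D"
proof -
  have "A \<bullet> hadamard U m D = (adj U ** A ** U) \<bullet> (\<chi> k l. m k l *\<^sub>R (adj U ** D ** U) $ k $ l)"
    unfolding hadamard_def by (rule inner_conj)
  also have "\<dots> = (adj U ** D ** U) \<bullet> (\<chi> k l. m k l *\<^sub>R (adj U ** A ** U) $ k $ l)"
    by (simp add: inner_vec_def inner_commute)
  also have "\<dots> = D \<bullet> hadamard U m A"
    unfolding hadamard_def by (rule inner_conj[symmetric])
  finally show ?thesis by (simp add: inner_commute)
qed

lemma hadamard_spectral:
  assumes "unitary U"
  shows "hadamard U m (spectral U a) = spectral U (\<lambda>k. m k k * a k)"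
proof -
  have "adj U ** spectral U a ** U = diag_mat a"
    using assms by (simp add: spectral_def matrix_mul_assoc[symmetric] unitary_cancel_left unitary_adj_mult)
  hence "(\<chi> k l. m k l *\<^sub>R (adj U ** spectral U a ** U) $ k $ l) = diag_mat (\<lambda>k. m k k * a k)"
    by (simp add: vec_eq_iff diag_mat_def scaleR_conv_of_real)
  thus ?thesis by (simp add: hadamard_def spectral_def)
qed

text \<open>Needed because the shift derivative of the divided difference of \<open>ln\<close> has a
  symbol of product form, which thereby becomes resolvent times perturbation times
  resolvent.\<close>

lemma hadamard_rank_one: "hadamard U (\<lambda>k l. x k * y l) D = spectral U x ** D ** spectral U y"
proof -
  have "(\<chi> k l. (x k * y l) *\<^sub>R (adj U ** D ** U) $ k $ l) =
      diag_mat x ** ((adj U ** D ** U) ** diag_mat y)"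
    by (simp add: vec_eq_iff diag_mat_mult_right diag_mat_mult_left)
  thus ?thesis by (simp add: hadamard_def spectral_def matrix_mul_assoc)
qed

lemma hadamard_quad_form:
  "v \<bullet> (hadamard U m D *v v) = (\<Sum>k\<in>UNIV. \<Sum>l\<in>UNIV. m k l *
     Re (cnj ((adj U *v v) $ k) * (adj U ** D ** U) $ k $ l * (adj U *v v) $ l))"
proof -
  let ?w = "adj U *v v" and ?M = "\<chi> k l. m k l *\<^sub>R (adj U ** D ** U) $ k $ l"
  have "v \<bullet> (hadamard U m D *v v) = ?w \<bullet> (?M *v ?w)"
    by (simp add: hadamard_def inner_mult_vector matrix_vector_mul_assoc[symmetric])
  also have "\<dots> = (\<Sum>k\<in>UNIV. \<Sum>l\<in>UNIV. Re (cnj (?w $ k) * ((m k l *\<^sub>R (adj U ** D ** U) $ k $ l) * ?w $ l)))"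
    unfolding inner_vec_def inner_complex_cnj matrix_vector_mult_def[of ?M]
    by (simp only: vec_lambda_beta sum_distrib_left Re_sum)
  also have "\<dots> = (\<Sum>k\<in>UNIV. \<Sum>l\<in>UNIV. m k l * Re (cnj (?w $ k) * (adj U ** D ** U) $ k $ l * ?w $ l))"
    by (intro sum.cong refl) (simp add: algebra_simps)
  finally show ?thesis .
qed

lemma norm_matrix_vector_le: "norm (A *v (x :: complex^'n)) \<le> norm A * norm x"
proof -
  have "norm ((A *v x) $ k) \<le> norm (A $ k) * norm x" for k
  proof -
    have "norm ((A *v x) $ k) \<le> (\<Sum>l\<in>UNIV. \<bar>cmod (A $ k $ l)\<bar> * \<bar>cmod (x $ l)\<bar>)"
      unfolding matrix_vector_mult_def
      by (simp add: norm_mult[symmetric]) (rule norm_sum)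
    also have "\<dots> \<le> norm (A $ k) * norm x"
      unfolding norm_vec_def by (rule L2_set_mult_ineq)
    finally show ?thesis .
  qed
  hence "norm (A *v x) \<le> L2_set (\<lambda>k. norm (A $ k) * norm x) UNIV"
    unfolding norm_vec_def[of "A *v x"] by (intro L2_set_mono) auto
  thus ?thesis by (simp add: L2_set_left_distrib[symmetric] norm_vec_def[of A])
qed

section \<open>The tangent gap of the logarithm\<close>

text \<open>The first divided difference of \<open>ln\<close>, with the derivative of
  \<open>ln\<close> on the diagonal: the symbol of L_\<sigma> in an eigenbasis.\<close>

definition ln_quot :: "real \<Rightarrow> real \<Rightarrow> real" where
  "ln_quot x y = (if x = y then 1 / x else (ln x - ln y) / (x - y))"

lemma ln_quot_commute: "ln_quot x y = ln_quot y x"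
  unfolding ln_quot_def by (metis minus_diff_eq minus_divide_divide)

lemma ln_quot_pos: "0 < x \<Longrightarrow> 0 < y \<Longrightarrow> 0 < ln_quot x y"
  by (cases x y rule: linorder_cases) (auto simp: ln_quot_def divide_neg_neg)

lemma ln_quot_same [simp]: "ln_quot x x = 1 / x"
  by (simp add: ln_quot_def)

text \<open>The difference \<open>x - y\<close> does not change under the shift, so only the
  numerator is differentiated, and the difference of the two reciprocals factors. The diagonal case
  obeys the same formula.\<close>

lemma DERIV_ln_quot:
  assumes "0 < x + s" "0 < y + s"
  shows "((\<lambda>s. ln_quot (x + s) (y + s)) has_real_derivative - (1 / (x + s) * (1 / (y + s)))) (at s)"
proof (cases "x = y")
  case True
  have "y + s \<noteq> 0" using assms by linarith
  moreover have "((\<lambda>s. y + s) has_real_derivative 1) (at s)"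
    by (auto intro!: derivative_eq_intros)
  ultimately have "((\<lambda>s. 1 / (y + s)) has_real_derivative - (1 / (y + s) * (1 / (y + s)))) (at s)"
    using DERIV_inverse'[of "\<lambda>s. y + s" 1 s UNIV] by (simp add: inverse_eq_divide)
  thus ?thesis unfolding True ln_quot_same .
next
  case False
  have "((\<lambda>s. (ln (x + s) - ln (y + s)) / (x - y)) has_real_derivative
      (1 / (x + s) - 1 / (y + s)) / (x - y)) (at s)"
    using assms False by (auto intro!: derivative_eq_intros)
  moreover have "(1 / (x + s) - 1 / (y + s)) / (x - y) = - (1 / (x + s) * (1 / (y + s)))"
    using assms False by (simp add: divide_simps)
  ultimately show ?thesis using False by (simp add: ln_quot_def)
qed

lemma ln_quot_tendsto_0: "((\<lambda>s. ln_quot (x + s) (y + s)) \<longlongrightarrow> 0) at_top"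
proof (cases "x = y")
  case True
  thus ?thesis unfolding ln_quot_def by simp real_asymp
next
  case False
  have "((\<lambda>s. ln (x + s) - ln (y + s)) \<longlongrightarrow> 0) at_top" by real_asymp
  from tendsto_divide[OF this tendsto_const, of "x - y"] False
  show ?thesis by (simp add: ln_quot_def)
qed

section \<open>Functions vanishing at infinity, controlled by their derivative\<close>

lemma DERIV_nonneg_tendsto_0:
  fixes f f' :: "real \<Rightarrow> real"
  assumes D: "\<And>s. 0 \<le> s \<Longrightarrow> (f has_real_derivative f' s) (at s)"
    and nn: "\<And>s. 0 \<le> s \<Longrightarrow> 0 \<le> f' s"
    and lim: "(f \<longlongrightarrow> 0) at_top" and "0 \<le> s"
  shows "f s \<le> 0"
proof (rule tendsto_lowerbound[OF lim])
  show "\<forall>\<^sub>F t in at_top. f s \<le> f t"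
    using eventually_ge_at_top[of s]
  proof eventually_elim
    case (elim t)
    thus ?case
    proof (rule DERIV_nonneg_imp_nondecreasing)
      fix x assume "s \<le> x"
      hence "0 \<le> x" using \<open>0 \<le> s\<close> by simp
      thus "\<exists>y. (f has_real_derivative y) (at x) \<and> 0 \<le> y" using D nn by blast
    qed
  qed
qed simp

lemma DERIV_pos_tendsto_0:
  fixes f f' :: "real \<Rightarrow> real"
  assumes D: "\<And>s. 0 \<le> s \<Longrightarrow> (f has_real_derivative f' s) (at s)"
    and nn: "\<And>s. 0 \<le> s \<Longrightarrow> 0 \<le> f' s"
    and lim: "(f \<longlongrightarrow> 0) at_top" and pos: "0 < f' 0"
  shows "f 0 < 0"
proof -
  obtain d where "0 < d" "\<And>h. 0 < h \<Longrightarrow> h < d \<Longrightarrow> f 0 < f (0 + h)"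
    using DERIV_pos_inc_right[OF D pos] by auto
  from this(2)[of "d / 2"] this(1) have "f 0 < f (d / 2)" by simp
  also have "\<dots> \<le> 0" by (rule DERIV_nonneg_tendsto_0[OF D nn lim]) (use \<open>0 < d\<close> in simp_all)
  finally show ?thesis .
qed

text \<open>The constant is the integral of K / (c + s)^3 over the half-line. Instead of
  integrating, the tail integral K / (2 (c + s)^2) is subtracted from \<open>- f\<close>, which
  leaves a nondecreasing function with limit 0.\<close>

lemma DERIV_bounded_tendsto_0:
  fixes f f' :: "real \<Rightarrow> real"
  assumes D: "\<And>s. 0 \<le> s \<Longrightarrow> (f has_real_derivative f' s) (at s)"
    and le: "\<And>s. 0 \<le> s \<Longrightarrow> f' s \<le> K / (c + s) ^ 3"
    and lim: "(f \<longlongrightarrow> 0) at_top" and c: "0 < c"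
  shows "- (K / (2 * c\<^sup>2)) \<le> f 0"
proof -
  define g where "g = (\<lambda>s. - f s - K / (2 * (c + s)\<^sup>2))"
  have "(g has_real_derivative - f' s + K / (c + s) ^ 3) (at s)" if "0 \<le> s" for s
  proof -
    have "((\<lambda>u. K / (2 * u\<^sup>2)) has_real_derivative - (K / u ^ 3)) (at u)" if "0 < u" for u :: real
      using that by (auto intro!: derivative_eq_intros simp: eval_nat_numeral divide_simps)
    moreover have "((\<lambda>s. c + s) has_real_derivative 1) (at s)"
      by (auto intro!: derivative_eq_intros)
    ultimately have "((\<lambda>s. K / (2 * (c + s)\<^sup>2)) has_real_derivative - (K / (c + s) ^ 3)) (at s)"
      using DERIV_chain2[of "\<lambda>u. K / (2 * u\<^sup>2)" _ "\<lambda>s. c + s" s 1] c that by force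
    from DERIV_diff[OF DERIV_minus[OF D[OF that]] this] show ?thesis
      by (simp add: g_def)
  qed
  moreover have "(g \<longlongrightarrow> 0) at_top"
  proof -
    have "((\<lambda>s. K / (2 * (c + s)\<^sup>2)) \<longlongrightarrow> 0) at_top" by real_asymp
    from tendsto_diff[OF tendsto_minus[OF lim] this] show ?thesis by (simp add: g_def)
  qed
  ultimately have "g 0 \<le> 0"
    using le by (intro DERIV_nonneg_tendsto_0[of g "\<lambda>s. - f' s + K / (c + s) ^ 3"]) auto
  thus ?thesis by (simp add: g_def)
qed

definition dlog :: "complex^'n^'n \<Rightarrow> ('n \<Rightarrow> real) \<Rightarrow> complex^'n^'n \<Rightarrow> complex^'n^'n" where
  "dlog U a = hadamard U (\<lambda>k l. ln_quot (a k) (a l))"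

text \<open>
  The gap between the logarithm and its tangent is monotone under the simultaneous shift
  \<open>A + s\<close>, \<open>B + s\<close> and vanishes as \<open>s \<longrightarrow> \<infinity>\<close>; this replaces the integral representation of the
  logarithm by resolvents.
\<close>

locale log_shift =
  fixes U V :: "complex^'n^'n" and a b :: "'n \<Rightarrow> real" and v :: "complex^'n"
  assumes U: "unitary U" and V: "unitary V" and a: "\<And>k. 0 < a k" and b: "\<And>k. 0 < b k"
begin

definition "\<Delta> = spectral V b - spectral U a"

text \<open>At \<open>s = 0\<close> this is the quadratic form at \<open>v\<close> of log B - log A
  - L_A(B - A). The shift cancels in B - A, so the same \<open>\<Delta>\<close> and the same
  eigenbases serve for every \<open>s\<close>.\<close>

definition "gap s = v \<bullet> ((spectral V (\<lambda>k. ln (b k + s)) - spectral U (\<lambda>k. ln (a k + s))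
    - dlog U (\<lambda>k. a k + s) \<Delta>) *v v)"

definition "res s = spectral U (\<lambda>k. 1 / (a k + s)) *v v"

definition "gap' s = (\<Delta> *v res s) \<bullet> (spectral V (\<lambda>k. 1 / (b k + s)) *v (\<Delta> *v res s))"

lemma shift_pos: "0 \<le> s \<Longrightarrow> 0 < a k + s" "0 \<le> s \<Longrightarrow> 0 < b k + s"
  using a[of k] b[of k] by simp_all

text \<open>The second-order resolvent expansion B^-1 = A^-1 - A^-1 \<Delta> A^-1 + A^-1 \<Delta>
  B^-1 \<Delta> A^-1 for the shifted matrices, evaluated as a quadratic form at \<open>v\<close>.
  Its last term is \<open>gap' s\<close>, with \<open>res s\<close> standing for A^-1 v.\<close>

lemma gap'_eq:
  assumes s: "0 \<le> s"
  shows "gap' s = v \<bullet> (spectral V (\<lambda>k. 1 / (b k + s)) *v v) - v \<bullet> (spectral U (\<lambda>k. 1 / (a k + s)) *v v)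
    + v \<bullet> (hadamard U (\<lambda>k l. 1 / (a k + s) * (1 / (a l + s))) \<Delta> *v v)"
proof -
  let ?A = "spectral U (\<lambda>k. a k + s)" and ?B = "spectral V (\<lambda>k. b k + s)"
  let ?Ai = "spectral U (\<lambda>k. 1 / (a k + s))" and ?Bi = "spectral V (\<lambda>k. 1 / (b k + s))"
  let ?r = "res s"
  have BA: "?B = ?A + \<Delta>"
    using U V by (simp add: spectral_shift \<Delta>_def)
  have Ar: "?A *v ?r = v"
    using spectral_inverse(1)[OF U, of "\<lambda>k. a k + s"] shift_pos(1)[OF s]
    by (simp add: res_def matrix_vector_mul_assoc less_imp_neq[symmetric])
  have "?Bi *v (?B *v ?r) = ?r"
    using spectral_inverse(2)[OF V, of "\<lambda>k. b k + s"] shift_pos(2)[OF s]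
    by (simp add: matrix_vector_mul_assoc less_imp_neq[symmetric])
  hence Bv: "?Bi *v v = ?r - ?Bi *v (\<Delta> *v ?r)"
    unfolding BA by (simp add: matrix_vector_mult_add_rdistrib Ar matrix_vector_right_distrib eq_diff_eq)
  have "v \<bullet> (?Bi *v v) = v \<bullet> ?r - v \<bullet> (?Bi *v (\<Delta> *v ?r))"
    by (simp add: Bv inner_diff_right)
  also have "v \<bullet> (?Bi *v (\<Delta> *v ?r)) = (?Bi *v v) \<bullet> (\<Delta> *v ?r)"
    by (rule inner_Herm_vector[OF spectral_Herm])
  also have "\<dots> = ?r \<bullet> (\<Delta> *v ?r) - gap' s"
    by (simp add: Bv inner_diff_right gap'_def inner_commute[of _ "\<Delta> *v res s"])
  also have "?r \<bullet> (\<Delta> *v ?r) = v \<bullet> (?Ai *v (\<Delta> *v ?r))"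
    unfolding inner_Herm_vector[OF spectral_Herm] by (simp add: res_def)
  also have "?Ai *v (\<Delta> *v ?r) = hadamard U (\<lambda>k l. 1 / (a k + s) * (1 / (a l + s))) \<Delta> *v v"
    by (simp only: hadamard_rank_one res_def matrix_vector_mul_assoc matrix_mul_assoc)
  finally show ?thesis by (simp add: res_def)
qed

text \<open>Written in the two fixed eigenbases, \<open>gap\<close> depends on \<open>s\<close> only
  through scalar coefficients. Differentiating these gives exactly the resolvent terms of
  \<open>gap'_eq\<close>.\<close>

lemma gap_DERIV:
  assumes s: "0 \<le> s"
  shows "(gap has_real_derivative gap' s) (at s)"
proof -
  define w where "w = adj U *v v"
  define z where "z = adj V *v v"
  define M where "M = adj U ** \<Delta> ** U"
  have gap: "gap = (\<lambda>s. (\<Sum>k\<in>UNIV. ln (b k + s) * (cmod (z $ k))\<^sup>2) - (\<Sum>k\<in>UNIV. ln (a k + s) * (cmod (w $ k))\<^sup>2)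
     - (\<Sum>k\<in>UNIV. \<Sum>l\<in>UNIV. ln_quot (a k + s) (a l + s) * Re (cnj (w $ k) * M $ k $ l * w $ l)))"
    unfolding gap_def dlog_def
    by (simp add: matrix_vector_mult_diff_rdistrib inner_diff_right spectral_quad_form
       hadamard_quad_form w_def z_def M_def)
  have gap': "gap' s = (\<Sum>k\<in>UNIV. 1 / (b k + s) * (cmod (z $ k))\<^sup>2) - (\<Sum>k\<in>UNIV. 1 / (a k + s) * (cmod (w $ k))\<^sup>2)
     - (\<Sum>k\<in>UNIV. \<Sum>l\<in>UNIV. - (1 / (a k + s) * (1 / (a l + s))) * Re (cnj (w $ k) * M $ k $ l * w $ l))"
    unfolding gap'_eq[OF s] spectral_quad_form hadamard_quad_form w_def z_def M_def
    by (simp only: mult_minus_left sum_negf diff_minus_eq_add)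
  have ln: "((\<lambda>s. ln (x + s)) has_real_derivative 1 / (x + s)) (at s)" if "0 < x + s" for x
    using that by (auto intro!: derivative_eq_intros)
  show ?thesis unfolding gap gap'
    by (intro DERIV_diff DERIV_sum DERIV_cmult_right DERIV_ln_quot ln shift_pos s)
qed

text \<open>Each logarithm diverges, but both spectral sums carry the same total weight
  \<open>v \<bullet> v\<close>, so \<open>ln s\<close> can be subtracted from every coefficient of
  both without changing the difference.\<close>

lemma gap_tendsto: "(gap \<longlongrightarrow> 0) at_top"
proof -
  define w where "w = adj U *v v"
  define z where "z = adj V *v v"
  define M where "M = adj U ** \<Delta> ** U"
  have wz: "(\<Sum>k\<in>UNIV. (cmod (z $ k))\<^sup>2) = (\<Sum>k\<in>UNIV. (cmod (w $ k))\<^sup>2)"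
    using U V by (simp add: w_def z_def unitary_norm_coords)
  have "gap s = (\<Sum>k\<in>UNIV. ln (b k + s) * (cmod (z $ k))\<^sup>2) - (\<Sum>k\<in>UNIV. ln (a k + s) * (cmod (w $ k))\<^sup>2)
     - (\<Sum>k\<in>UNIV. \<Sum>l\<in>UNIV. ln_quot (a k + s) (a l + s) * Re (cnj (w $ k) * M $ k $ l * w $ l))" for s
    unfolding gap_def dlog_def
    by (simp add: matrix_vector_mult_diff_rdistrib inner_diff_right spectral_quad_form
       hadamard_quad_form w_def z_def M_def)
  also have "\<dots>s = (\<Sum>k\<in>UNIV. (ln (b k + s) - ln s) * (cmod (z $ k))\<^sup>2) - (\<Sum>k\<in>UNIV. (ln (a k + s) - ln s) * (cmod (w $ k))\<^sup>2)
     - (\<Sum>k\<in>UNIV. \<Sum>l\<in>UNIV. ln_quot (a k + s) (a l + s) * Re (cnj (w $ k) * M $ k $ l * w $ l))" for s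
    by (simp add: left_diff_distrib sum_subtractf sum_distrib_left[symmetric] wz)
  finally have gap: "gap = (\<lambda>s. (\<Sum>k\<in>UNIV. (ln (b k + s) - ln s) * (cmod (z $ k))\<^sup>2)
     - (\<Sum>k\<in>UNIV. (ln (a k + s) - ln s) * (cmod (w $ k))\<^sup>2)
     - (\<Sum>k\<in>UNIV. \<Sum>l\<in>UNIV. ln_quot (a k + s) (a l + s) * Re (cnj (w $ k) * M $ k $ l * w $ l)))"
    by (rule ext)
  have "((\<lambda>s. ln (x + s) - ln s) \<longlongrightarrow> 0) at_top" for x :: real by real_asymp
  hence "(gap \<longlongrightarrow> (\<Sum>k\<in>(UNIV::'n set). 0 * (cmod (z $ k))\<^sup>2) - (\<Sum>k\<in>(UNIV::'n set). 0 * (cmod (w $ k))\<^sup>2)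
     - (\<Sum>k\<in>(UNIV::'n set). \<Sum>l\<in>(UNIV::'n set). 0 * Re (cnj (w $ k) * M $ k $ l * w $ l))) at_top"
    unfolding gap by (intro tendsto_intros ln_quot_tendsto_0)
  thus ?thesis by simp
qed

lemma gap'_nonneg: "0 \<le> s \<Longrightarrow> 0 \<le> gap' s"
  unfolding gap'_def spectral_quad_form
  by (intro sum_nonneg mult_nonneg_nonneg) (use shift_pos[THEN less_imp_le] in auto)

lemma gap_le_0: "gap 0 \<le> 0"
  by (rule DERIV_nonneg_tendsto_0[OF gap_DERIV gap'_nonneg gap_tendsto]) simp_all

lemma gap_less_0:
  assumes "\<Delta> *v res 0 \<noteq> 0"
  shows "gap 0 < 0"
proof (rule DERIV_pos_tendsto_0[OF gap_DERIV gap'_nonneg gap_tendsto])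
  have "pos_def (spectral V (\<lambda>k. 1 / (b k + 0)))"
    using b by (simp add: pos_def_spectral[OF V])
  thus "0 < gap' 0" unfolding gap'_def using assms by (simp add: pos_def_iff)
qed simp_all

text \<open>The cube comes from three resolvents, each bounded by 1 / (c + s): two in the squared
  norm of \<open>res s\<close>, and one from the shifted second matrix.\<close>

lemma gap_ge:
  assumes c: "0 < c" "\<And>k. c \<le> a k" "\<And>k. c \<le> b k"
  shows "- ((norm \<Delta>)\<^sup>2 * (norm v)\<^sup>2 / (2 * c\<^sup>2)) \<le> gap 0"
proof (rule DERIV_bounded_tendsto_0[OF gap_DERIV _ gap_tendsto c(1)])
  fix s :: real
  assume s: "0 \<le> s"
  let ?y = "\<Delta> *v res s"
  have cs: "0 < c + s" using c(1) s by simp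
  have "(norm (res s))\<^sup>2 = v \<bullet> (spectral U (\<lambda>k. 1 / (a k + s) * (1 / (a k + s))) *v v)"
    unfolding res_def power2_norm_eq_inner inner_Herm_vector[OF spectral_Herm, symmetric]
    by (simp only: spectral_mult[OF U, symmetric] matrix_vector_mul_assoc)
  also have "\<dots> \<le> (1 / (c + s) * (1 / (c + s))) * (v \<bullet> v)"
    by (rule spectral_quad_form_le[OF U])
      (use cs c(2) in \<open>auto intro!: mult_mono frac_le divide_nonneg_nonneg intro: less_imp_le order.trans[OF c(1)[THEN less_imp_le]] add_nonneg_nonneg s\<close>)
  finally have r: "(norm (res s))\<^sup>2 \<le> (1 / (c + s))\<^sup>2 * (norm v)\<^sup>2"
    by (simp add: power2_norm_eq_inner power2_eq_square[of "1 / (c + s)"])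
  have "gap' s \<le> 1 / (c + s) * (norm ?y)\<^sup>2"
    unfolding gap'_def power2_norm_eq_inner
    by (rule spectral_quad_form_le[OF V]) (use cs c(3) in \<open>auto intro!: frac_le\<close>)
  also have "\<dots> \<le> 1 / (c + s) * ((norm \<Delta>)\<^sup>2 * (norm (res s))\<^sup>2)"
    using norm_matrix_vector_le[of \<Delta> "res s"] cs
    by (intro mult_left_mono) (auto simp: power_mult_distrib[symmetric] intro!: power_mono)
  also have "\<dots> \<le> 1 / (c + s) * ((norm \<Delta>)\<^sup>2 * ((1 / (c + s))\<^sup>2 * (norm v)\<^sup>2))"
    using r cs by (intro mult_left_mono) auto
  also have "\<dots> = (norm \<Delta>)\<^sup>2 * (norm v)\<^sup>2 / (c + s) ^ 3"
    by (simp add: power3_eq_cube power2_eq_square)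
  finally show "gap' s \<le> (norm \<Delta>)\<^sup>2 * (norm v)\<^sup>2 / (c + s) ^ 3" .
qed

end

section \<open>The derivative of the matrix logarithm\<close>

lemma column_unitary_inner:
  assumes "unitary U"
  shows "column k U \<bullet> column k U = 1"
  using column_spectral_quad_form[OF assms, of k "\<lambda>_. 1"] by (simp add: spectral_const assms)

lemma quad_form_abs_le: "\<bar>v \<bullet> (A *v v)\<bar> \<le> norm A * (v \<bullet> (v :: complex^'n))"
proof -
  have "\<bar>v \<bullet> (A *v v)\<bar> \<le> norm v * (norm A * norm v)"
    by (rule order_trans[OF Cauchy_Schwarz_ineq2 mult_left_mono[OF norm_matrix_vector_le]]) simp
  thus ?thesis by (simp add: power2_norm_eq_inner[symmetric] power2_eq_square mult_ac)
qed

lemma norm_spectral: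
  assumes "unitary U"
  shows "(norm (spectral U a))\<^sup>2 = (\<Sum>k\<in>UNIV. (a k)\<^sup>2)"
  unfolding power2_norm_eq_inner inner_spectral column_spectral_quad_form[OF assms]
  by (simp add: power2_eq_square)

lemma trace_spectral:
  assumes "unitary U"
  shows "Re (trace (spectral U a)) = (\<Sum>k\<in>UNIV. a k)"
proof -
  have "Re (trace (spectral U a)) = mat 1 \<bullet> spectral U a"
    by (simp add: inner_matrix_trace)
  thus ?thesis by (simp add: inner_spectral column_unitary_inner[OF assms])
qed

text \<open>For nonnegative eigenvalues the sum of squares is at most the square of the sum, since
  the cross terms are nonnegative. It bounds the set of states and, later, the entries of factor
  states.\<close>

lemma norm_psd_le_trace:
  assumes "psd A"
  shows "norm A \<le> Re (trace A)"
proof -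
  obtain U a where U: "unitary U" and A: "A = spectral U a" and a: "\<And>k. 0 \<le> a k"
    using psd_obtain_spectral[OF assms] by blast
  have "(norm A)\<^sup>2 \<le> (Re (trace A))\<^sup>2"
    unfolding A norm_spectral[OF U] trace_spectral[OF U]
    unfolding power2_eq_square sum_product
    by (intro sum_mono member_le_sum[of _ UNIV "\<lambda>j. a _ * a j"]) (simp_all add: a)
  moreover have "0 \<le> Re (trace A)"
    unfolding A trace_spectral[OF U] by (simp add: sum_nonneg a)
  ultimately show ?thesis by (rule power2_le_imp_le)
qed

text \<open>The hypothesis bounds every eigenvalue by \<open>C\<close>; the norm here is the
  Frobenius norm, which costs the square root of the dimension.\<close>

lemma norm_Herm_le:
  fixes X :: "complex^'n^'n"
  assumes X: "X \<in> Herm" and C: "\<And>v. \<bar>v \<bullet> (X *v v)\<bar> \<le> C * (v \<bullet> v)"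
  shows "norm X \<le> sqrt (of_nat CARD('n)) * C"
proof -
  obtain U a where U: "unitary U" and A: "X = spectral U a"
    using Herm_spectral[OF X] by blast
  have a: "\<bar>a k\<bar> \<le> C" for k
    using C[of "column k U"] by (simp add: A column_spectral_quad_form[OF U] column_unitary_inner[OF U])
  have C0: "0 \<le> C" using a[of undefined] by linarith
  have "(norm X)\<^sup>2 \<le> (\<Sum>k\<in>(UNIV::'n set). C\<^sup>2)"
    unfolding A norm_spectral[OF U] using a
    by (intro sum_mono) (metis abs_ge_zero power_mono power2_abs)
  also have "\<dots> = (sqrt (of_nat CARD('n)) * C)\<^sup>2"
    by (simp add: power_mult_distrib)
  finally show ?thesis by (rule power2_le_imp_le) (simp add: C0)
qed

lemma inner_psd_mono:
  assumes "psd \<rho>" "\<And>v. v \<bullet> (X *v v) \<le> v \<bullet> (Y *v v)"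
  shows "\<rho> \<bullet> X \<le> \<rho> \<bullet> Y"
proof -
  obtain U a where \<rho>: "\<rho> = spectral U a" and a: "\<And>k. 0 \<le> a k"
    using psd_obtain_spectral[OF assms(1)] by blast
  show ?thesis unfolding \<rho> inner_commute[of "spectral U a"] inner_spectral
    by (intro sum_mono mult_left_mono assms(2) a)
qed

lemma pos_def_bound:
  assumes "pos_def A"
  obtains c where "0 < c" "\<And>v. c * (v \<bullet> v) \<le> v \<bullet> (A *v v)"
proof -
  obtain U a where U: "unitary U" and A: "A = spectral U a" and a: "\<And>k. 0 < a k"
    using pos_def_obtain_spectral[OF assms] by blast
  have "0 < Min (range a)" "\<And>k. Min (range a) \<le> a k" using a by auto
  thus thesis using that[of "Min (range a)"] spectral_quad_form_ge[OF U, of "Min (range a)" a] by (simp add: A)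
qed

lemma dlog_Herm: "D \<in> Herm \<Longrightarrow> dlog U a D \<in> Herm"
  unfolding dlog_def by (rule hadamard_Herm) (simp_all add: ln_quot_commute)

lemma dlog_scaleR: "dlog U a (c *\<^sub>R D) = c *\<^sub>R dlog U a D"
  by (simp add: dlog_def hadamard_scaleR)

lemma mat_log_remainder_le:
  assumes U: "unitary U" and a: "\<And>k. 0 < a k" and B: "pos_def B"
  shows "v \<bullet> ((mat_log B - mat_log (spectral U a) - dlog U a (B - spectral U a)) *v v) \<le> 0"
proof -
  obtain V b where V: "unitary V" and B': "B = spectral V b" and b: "\<And>k. 0 < b k"
    using pos_def_obtain_spectral[OF B] by blast
  interpret log_shift U V a b v by unfold_locales fact+
  show ?thesis using gap_le_0
    by (simp add: gap_def \<Delta>_def B' mat_log_spectral U V)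
qed

lemma mat_log_remainder_less:
  assumes U: "unitary U" and a: "\<And>k. 0 < a k" and B: "pos_def B"
    and ne: "(B - spectral U a) *v (spectral U (\<lambda>k. 1 / a k) *v v) \<noteq> 0"
  shows "v \<bullet> ((mat_log B - mat_log (spectral U a) - dlog U a (B - spectral U a)) *v v) < 0"
proof -
  obtain V b where V: "unitary V" and B': "B = spectral V b" and b: "\<And>k. 0 < b k"
    using pos_def_obtain_spectral[OF B] by blast
  interpret log_shift U V a b v by unfold_locales fact+
  show ?thesis using gap_less_0 ne
    by (simp add: gap_def \<Delta>_def B' mat_log_spectral U V res_def)
qed

lemma mat_log_remainder_ge:
  assumes U: "unitary U" and c: "0 < c" and ca: "\<And>k. c \<le> a k" and B: "B \<in> Herm"
    and Bc: "\<And>v. c * (v \<bullet> v) \<le> v \<bullet> (B *v v)"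
  shows "- ((norm (B - spectral U a))\<^sup>2 / (2 * c\<^sup>2) * (v \<bullet> v))
    \<le> v \<bullet> ((mat_log B - mat_log (spectral U a) - dlog U a (B - spectral U a)) *v v)"
proof -
  obtain V b where V: "unitary V" and B': "B = spectral V b"
    using Herm_spectral[OF B] by blast
  have cb: "c \<le> b k" for k
    using Bc[of "column k V"]
    by (simp add: B' column_spectral_quad_form[OF V] column_unitary_inner[OF V])
  interpret log_shift U V a b v
    by unfold_locales (use U V c ca cb in \<open>auto intro: less_le_trans\<close>)
  show ?thesis using gap_ge[OF c ca cb]
    by (simp add: gap_def \<Delta>_def B' mat_log_spectral U V power2_norm_eq_inner)
qed

text \<open>The remainder has quadratic forms between a negative multiple of t^2 and 0. Being
  Hermitian, it is therefore O(t^2) in norm.\<close>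

lemma mat_log_has_vector_derivative:
  fixes \<beta> :: "complex^'n^'n"
  assumes U: "unitary U" and a: "\<And>k. 0 < a k" and \<beta>: "\<beta> \<in> Herm"
  shows "((\<lambda>t. mat_log (spectral U a + t *\<^sub>R \<beta>)) has_vector_derivative dlog U a \<beta>) (at 0)"
proof -
  let ?A = "spectral U a"
  \<comment> \<open>Half the least eigenvalue: for \<bar>t\<bar> < d the perturbation uses up at
    most the other half, so both matrices stay above \<open>c\<close>.\<close>
  define c where "c = Min (range a) / 2"
  have c: "0 < c" "2 * c \<le> a k" for k using a by (auto simp: c_def)
  define d where "d = c / (norm \<beta> + 1)"
  define K where "K = sqrt (of_nat CARD('n)) * ((norm \<beta>)\<^sup>2 / (2 * c\<^sup>2))"
  have nb: "0 < norm \<beta> + 1" by (simp add: add_nonneg_pos)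
  have d: "0 < d" using c nb by (simp add: d_def)
  have bound: "norm (mat_log (?A + t *\<^sub>R \<beta>) - mat_log ?A - t *\<^sub>R dlog U a \<beta>) \<le> K * t\<^sup>2"
    if t: "\<bar>t\<bar> < d" for t
  proof -
    let ?B = "?A + t *\<^sub>R \<beta>"
    let ?X = "mat_log ?B - mat_log ?A - dlog U a (?B - ?A)"
    have B: "?B \<in> Herm" by (simp add: Herm_add Herm_scaleR spectral_Herm \<beta>)
    have Bc: "c * (v \<bullet> v) \<le> v \<bullet> (?B *v v)" for v
    proof -
      have "\<bar>t\<bar> * norm \<beta> \<le> d * (norm \<beta> + 1)" using t by (intro mult_mono) auto
      also have "\<dots> = c" using nb by (simp add: d_def)
      finally have "\<bar>t\<bar> * norm \<beta> \<le> c" .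
      hence "\<bar>t * (v \<bullet> (\<beta> *v v))\<bar> \<le> c * (v \<bullet> v)"
        using quad_form_abs_le[of v \<beta>] unfolding abs_mult
        by (metis (no_types) abs_ge_zero inner_ge_zero mult.assoc mult_left_mono mult_right_mono order_trans)
      moreover have "2 * c * (v \<bullet> v) \<le> v \<bullet> (?A *v v)"
        by (rule spectral_quad_form_ge[OF U c(2)])
      ultimately show ?thesis
        by (simp add: matrix_vector_mult_add_rdistrib inner_add_right matrix_vector_mul_scaleR_left)
    qed
    have "\<And>v. v \<noteq> 0 \<Longrightarrow> 0 < v \<bullet> (?B *v v)"
      using Bc c(1) by (meson inner_gt_zero_iff less_le_trans mult_pos_pos)
    hence Bp: "pos_def ?B" using B by (simp add: pos_def_iff)
    have "\<bar>v \<bullet> (?X *v v)\<bar> \<le> (norm (?B - ?A))\<^sup>2 / (2 * c\<^sup>2) * (v \<bullet> v)" for v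
    proof -
      have "c \<le> a k" for k using c(1) c(2)[of k] by linarith
      from mat_log_remainder_ge[where v = v and a = a, OF U c(1) this B Bc] mat_log_remainder_le[where v = v and a = a, OF U a Bp]
      show ?thesis by linarith
    qed
    moreover have "?X \<in> Herm"
      by (intro Herm_diff mat_log_Herm B spectral_Herm dlog_Herm)
    ultimately have "norm ?X \<le> sqrt (of_nat CARD('n)) * ((norm (?B - ?A))\<^sup>2 / (2 * c\<^sup>2))"
      by (intro norm_Herm_le)
    thus ?thesis by (simp add: K_def dlog_scaleR power_mult_distrib mult_ac)
  qed
  show ?thesis unfolding has_vector_derivative_def
  proof (rule has_derivativeI_sandwich[OF d])
    show "bounded_linear (\<lambda>x. x *\<^sub>R dlog U a \<beta>)" by (rule bounded_linear_scaleR_left)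
    show "((\<lambda>t. K * \<bar>t\<bar>) \<longlongrightarrow> 0) (at 0)" by (rule tendsto_eq_intros refl | simp)+
    show "norm (mat_log (?A + t *\<^sub>R \<beta>) - mat_log (?A + 0 *\<^sub>R \<beta>) - (t - 0) *\<^sub>R dlog U a \<beta>) / norm (t - 0)
        \<le> K * \<bar>t\<bar>" if "t \<noteq> 0" "dist t 0 < d" for t
      using bound[of t] that by (simp add: divide_le_eq power2_eq_square mult.assoc)
  qed
qed

section \<open>The operator L_\<sigma> and its inverse\<close>

lemma L_op_spectral:
  assumes "unitary U" "\<And>k. 0 < a k" "\<beta> \<in> Herm"
  shows "L_op (spectral U a) \<beta> = dlog U a \<beta>"
  unfolding L_op_def by (rule vector_derivative_at[OF mat_log_has_vector_derivative[OF assms]])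

lemma pos_def_obtain_L_op:
  assumes "pos_def \<sigma>"
  obtains U a where "unitary U" "\<And>k. 0 < a k" "\<sigma> = spectral U a"
    "\<And>\<beta>. \<beta> \<in> Herm \<Longrightarrow> L_op \<sigma> \<beta> = dlog U a \<beta>"
proof -
  obtain U a where U: "unitary U" "\<sigma> = spectral U a" "\<And>k. 0 < a k"
    using pos_def_obtain_spectral[OF assms] by blast
  show thesis by (rule that[of U a]) (use U L_op_spectral in auto)
qed

lemma mat_log_deriv:
  assumes "pos_def \<sigma>" "\<beta> \<in> Herm"
  shows "((\<lambda>t. mat_log (\<sigma> + t *\<^sub>R \<beta>)) has_vector_derivative L_op \<sigma> \<beta>) (at 0)"
proof (rule pos_def_obtain_L_op[OF assms(1)])
  fix U a
  assume "unitary U" "\<And>k. 0 < a k" "\<sigma> = spectral U a"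
    "\<And>\<beta>. \<beta> \<in> Herm \<Longrightarrow> L_op \<sigma> \<beta> = dlog U a \<beta>"
  thus ?thesis using mat_log_has_vector_derivative[of U a \<beta>] assms(2) by simp
qed

lemma L_op_Herm: "pos_def \<sigma> \<Longrightarrow> \<beta> \<in> Herm \<Longrightarrow> L_op \<sigma> \<beta> \<in> Herm"
  by (erule pos_def_obtain_L_op) (simp add: dlog_Herm)

lemma L_op_inner:
  "pos_def \<sigma> \<Longrightarrow> A \<in> Herm \<Longrightarrow> B \<in> Herm \<Longrightarrow> A \<bullet> L_op \<sigma> B = L_op \<sigma> A \<bullet> B"
  by (erule pos_def_obtain_L_op) (simp add: dlog_def inner_hadamard)

lemma L_op_diff:
  "pos_def \<sigma> \<Longrightarrow> A \<in> Herm \<Longrightarrow> B \<in> Herm \<Longrightarrow> L_op \<sigma> (A - B) = L_op \<sigma> A - L_op \<sigma> B"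
  by (erule pos_def_obtain_L_op) (simp add: dlog_def Herm_diff linear_diff[OF linear_hadamard])

lemma L_op_scaleR: "pos_def \<sigma> \<Longrightarrow> A \<in> Herm \<Longrightarrow> L_op \<sigma> (c *\<^sub>R A) = c *\<^sub>R L_op \<sigma> A"
  by (erule pos_def_obtain_L_op) (simp add: dlog_scaleR Herm_scaleR)

lemma L_op_self:
  assumes "pos_def \<sigma>"
  shows "L_op \<sigma> \<sigma> = mat 1"
proof -
  obtain U a where U: "unitary U" and A: "\<sigma> = spectral U a" and a: "\<And>k. 0 < a k"
    using pos_def_obtain_spectral[OF assms] by blast
  have "(\<lambda>k. ln_quot (a k) (a k) * a k) = (\<lambda>_. 1)" using a by (auto simp: less_imp_neq[symmetric])
  thus ?thesis
    by (simp add: A L_op_spectral[OF U a spectral_Herm] dlog_def hadamard_spectral[OF U] spectral_const[OF U])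
qed

text \<open>The symbol is strictly positive, so the reciprocal symbol is a two-sided inverse, and
  both symbols are symmetric, hence preserve \<open>Herm\<close>. This is what lets
  \<open>L_inv\<close> be used as a genuine inverse.\<close>

lemma L_op_bij:
  assumes "pos_def \<sigma>"
  shows "bij_betw (L_op \<sigma>) Herm Herm"
proof -
  obtain U a where U: "unitary U" and A: "\<sigma> = spectral U a" and a: "\<And>k. 0 < a k"
    using pos_def_obtain_spectral[OF assms] by blast
  let ?m = "\<lambda>k l. ln_quot (a k) (a l)"
  have m: "?m k l \<noteq> 0" for k l using ln_quot_pos[OF a a] by (metis less_irrefl)
  have L: "L_op \<sigma> B = hadamard U ?m B" if "B \<in> Herm" for B
    using L_op_spectral[OF U a that] by (simp add: A dlog_def)
  let ?M = "hadamard U (\<lambda>k l. 1 / ?m k l)"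
  have M: "?M B \<in> Herm" if "B \<in> Herm" for B
    using that by (rule hadamard_Herm) (simp add: ln_quot_commute)
  have LH: "hadamard U ?m B \<in> Herm" if "B \<in> Herm" for B
    using that by (rule hadamard_Herm) (simp add: ln_quot_commute)
  show ?thesis
    by (rule bij_betw_byWitness[of _ ?M])
      (auto simp: L M LH hadamard_compose[OF U] m hadamard_one[OF U])
qed

lemma L_inv_Herm: "pos_def \<sigma> \<Longrightarrow> \<phi> \<in> Herm \<Longrightarrow> L_inv \<sigma> \<phi> \<in> Herm"
  unfolding L_inv_def using L_op_bij by (metis bij_betw_imp_surj_on inv_into_into)

lemma L_op_L_inv: "pos_def \<sigma> \<Longrightarrow> \<phi> \<in> Herm \<Longrightarrow> L_op \<sigma> (L_inv \<sigma> \<phi>) = \<phi>"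
  unfolding L_inv_def using L_op_bij by (metis bij_betw_inv_into_right)

lemma L_inv_L_op: "pos_def \<sigma> \<Longrightarrow> \<beta> \<in> Herm \<Longrightarrow> L_inv \<sigma> (L_op \<sigma> \<beta>) = \<beta>"
  unfolding L_inv_def using L_op_bij by (metis bij_betw_inv_into_left)

lemma mat_log_tangent:
  assumes \<rho>: "psd \<rho>" and A: "pos_def A" and B: "pos_def B"
  shows "\<rho> \<bullet> mat_log B \<le> \<rho> \<bullet> mat_log A + \<rho> \<bullet> L_op A (B - A)"
proof -
  obtain U a where U: "unitary U" and A': "A = spectral U a" and a: "\<And>k. 0 < a k"
    using pos_def_obtain_spectral[OF A] by blast
  have "\<rho> \<bullet> (mat_log B - mat_log A - L_op A (B - A)) \<le> \<rho> \<bullet> (0 :: complex^'a^'a)"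
    using mat_log_remainder_le[where a = a, OF U a B] L_op_spectral[OF U a, of "B - A"] A B
    by (intro inner_psd_mono[OF \<rho>]) (simp add: A' Herm_diff pos_def_Herm)
  thus ?thesis by (simp add: inner_diff_right)
qed

text \<open>Expanded in an eigenbasis of \<rho>, the pairing is a sum of nonpositive terms with
  positive weights, so one strict term is enough. If none were strict, B - A would annihilate the
  image of a basis under the invertible A^-1, forcing B = A.\<close>

lemma mat_log_tangent_strict:
  fixes \<rho> :: "complex^'n^'n"
  assumes \<rho>: "pos_def \<rho>" and A: "pos_def A" and B: "pos_def B" and ne: "B \<noteq> A"
  shows "\<rho> \<bullet> mat_log B < \<rho> \<bullet> mat_log A + \<rho> \<bullet> L_op A (B - A)"
proof -
  obtain U a where U: "unitary U" and A': "A = spectral U a" and a: "\<And>k. 0 < a k"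
    using pos_def_obtain_spectral[OF A] by blast
  obtain W r where W: "unitary W" and \<rho>': "\<rho> = spectral W r" and r: "\<And>k. 0 < r k"
    using pos_def_obtain_spectral[OF \<rho>] by blast
  let ?Ai = "spectral U (\<lambda>k. 1 / a k)" and ?Z = "mat_log B - mat_log A - L_op A (B - A)"
  have Z: "?Z = mat_log B - mat_log (spectral U a) - dlog U a (B - spectral U a)"
    using L_op_spectral[OF U a, of "B - A"] A B by (simp add: A' Herm_diff pos_def_Herm)
  have "\<exists>k. (B - A) *v (?Ai *v column k W) \<noteq> 0"
  proof (rule ccontr)
    assume "\<not> ?thesis"
    hence "((B - A) ** ?Ai ** W) *v axis k 1 = 0" for k
      unfolding matrix_vector_mul_assoc[symmetric] unfolding mult_axis_column by simp
    hence "(B - A) ** ?Ai ** W = 0"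
      by (simp add: mult_axis_column) (simp add: column_def vec_eq_iff)
    hence "(B - A) ** ?Ai ** W ** adj W ** A = 0" by simp
    hence "B - A = 0"
      using spectral_inverse(2)[OF U, of a] a
      by (simp add: matrix_mul_assoc[symmetric] unitary_mult_adj[OF W] A' less_imp_neq[symmetric])
    thus False using ne by simp
  qed
  then obtain k where k: "(B - A) *v (?Ai *v column k W) \<noteq> 0" by blast
  have "(\<Sum>k\<in>UNIV. r k * (column k W \<bullet> (?Z *v column k W))) < (\<Sum>k\<in>(UNIV::'n set). 0)"
  proof (rule sum_strict_mono_ex1)
    show "\<forall>k\<in>UNIV. r k * (column k W \<bullet> (?Z *v column k W)) \<le> 0"
      unfolding Z using mat_log_remainder_le[where a = a, OF U a B]
      by (auto intro!: mult_nonneg_nonpos less_imp_le[OF r])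
    show "\<exists>k\<in>UNIV. r k * (column k W \<bullet> (?Z *v column k W)) < 0"
      using mat_log_remainder_less[where a = a, OF U a B k[unfolded A']] r unfolding Z
      by (auto intro!: exI[of _ k] mult_pos_neg)
  qed simp
  hence "\<rho> \<bullet> ?Z < 0"
    unfolding \<rho>' inner_commute[of "spectral W r"] inner_spectral by simp
  thus ?thesis by (simp add: inner_diff_right)
qed

section \<open>States, and rays of states through a positive definite matrix\<close>

lemma spectral_column_eq_0:
  assumes U: "unitary U" and "a k = 0"
  shows "spectral U a *v column k U = 0"
proof -
  have "(spectral U a *v column k U) \<bullet> (spectral U a *v column k U) = a k * a k"
    unfolding inner_Herm_vector[OF spectral_Herm, symmetric] column_spectral_quad_form[OF U, symmetric]
      spectral_mult[OF U, symmetric] matrix_vector_mul_assoc by (simp add: spectral_mult[OF U] column_spectral_quad_form[OF U])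
  thus ?thesis using assms(2) by simp
qed

lemma psd_kernel_or_pos_def:
  assumes "psd A"
  shows "pos_def A \<or> (\<exists>v. v \<noteq> 0 \<and> A *v v = 0)"
proof -
  obtain U a where U: "unitary U" and A: "A = spectral U a" and a: "\<And>k. 0 \<le> a k"
    using psd_obtain_spectral[OF assms] by blast
  show ?thesis
  proof (cases "\<forall>k. 0 < a k")
    case False
    then obtain k where k: "a k = 0" using a by (metis less_eq_real_def)
    have "A *v column k U = 0" unfolding A by (rule spectral_column_eq_0[of U a, OF U k])
    thus ?thesis using column_unitary_nonzero[OF U] by blast
  qed (simp add: A pos_def_spectral[OF U])
qed

text \<open>The zero vector has to be treated apart, since positive definiteness says nothing about
  it.\<close>

lemma pos_def_psd: "pos_def A \<Longrightarrow> psd A"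
  unfolding pos_def_iff psd_iff by (metis inner_zero_left less_eq_real_def order_refl)

lemma pos_def_add_scaled:
  assumes "psd A" "0 < s"
  shows "pos_def (A + s *\<^sub>R mat 1)"
proof -
  obtain U a where U: "unitary U" and A: "A = spectral U a" and a: "\<And>k. 0 \<le> a k"
    using psd_obtain_spectral[OF assms(1)] by blast
  show ?thesis
    using assms(2) a by (simp add: A spectral_shift[OF U, symmetric] pos_def_spectral[OF U] add_nonneg_pos)
qed

section \<open>Topology and convexity of the set of states\<close>

lemma closed_Herm: "closed (Herm :: (complex^'n^'n) set)"
proof -
  have *: "Herm = (\<Inter>k. \<Inter>l. {A :: complex^'n^'n. A $ k $ l = cnj (A $ l $ k)})"
    by (auto simp: Herm_def hermitian_on_def)
  show ?thesis unfolding *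
    by (intro closed_INT ballI closed_Collect_eq continuous_intros)
qed

lemma continuous_on_quad_form: "continuous_on S (\<lambda>A :: complex^'n^'n. v \<bullet> (A *v v))"
proof -
  have "linear (\<lambda>A :: complex^'n^'n. v \<bullet> (A *v v))"
    by (rule linearI)
      (simp_all add: matrix_vector_mult_add_rdistrib inner_add_right matrix_vector_mul_scaleR_left)
  thus ?thesis by (rule linear_continuous_on[OF linear_conv_bounded_linear[THEN iffD1]])
qed

lemma closed_psd: "closed {A :: complex^'n^'n. psd A}"
proof -
  have *: "{A :: complex^'n^'n. psd A} = Herm \<inter> (\<Inter>v. {A. 0 \<le> v \<bullet> (A *v v)})"
    by (auto simp: psd_iff)
  show ?thesis unfolding *
    by (intro closed_Int closed_Herm closed_INT ballI closed_Collect_le continuous_on_quad_form continuous_intros)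
qed

lemma continuous_on_trace: "continuous_on S (trace :: complex^'n^'n \<Rightarrow> complex)"
  unfolding trace_def by (intro continuous_intros)

lemma compact_states: "compact (states :: (complex^'n^'n) set)"
proof (rule compact_eq_bounded_closed[THEN iffD2, OF conjI])
  show "bounded (states :: (complex^'n^'n) set)"
    unfolding bounded_iff states_def using norm_psd_le_trace by (intro exI[of _ 1]) force
  have *: "states = {A :: complex^'n^'n. psd A} \<inter> {A. trace A = 1}"
    by (auto simp: states_def)
  show "closed (states :: (complex^'n^'n) set)" unfolding *
    by (intro closed_Int closed_psd closed_Collect_eq continuous_on_trace continuous_intros)
qed

lemma psd_add: "psd A \<Longrightarrow> psd B \<Longrightarrow> psd (A + B)"
  and psd_scaleR: "psd A \<Longrightarrow> 0 \<le> c \<Longrightarrow> psd (c *\<^sub>R A)"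
  by (simp_all add: psd_iff Herm_add Herm_scaleR matrix_vector_mult_add_rdistrib inner_add_right
      matrix_vector_mul_scaleR_left)

lemma convex_states: "convex (states :: (complex^'n^'n) set)"
proof (rule convexI)
  fix A B :: "complex^'n^'n" and u v :: real
  assume "A \<in> states" "B \<in> states" "0 \<le> u" "0 \<le> v" "u + v = 1"
  thus "u *\<^sub>R A + v *\<^sub>R B \<in> states"
    by (auto simp: states_def psd_add psd_scaleR trace_add trace_scaleR scaleR_left_distrib[symmetric])
qed

lemma states_Herm: "A \<in> states \<Longrightarrow> A \<in> Herm"
  and states_psd: "A \<in> states \<Longrightarrow> psd A"
  by (simp_all add: states_def psd_Herm)

lemma pos_def_convex:
  assumes "pos_def A" "psd B" "0 \<le> t" "t < 1"
  shows "pos_def ((1 - t) *\<^sub>R A + t *\<^sub>R B)"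
  using assms unfolding pos_def_iff psd_iff
  by (auto simp: Herm_add Herm_scaleR matrix_vector_mult_add_rdistrib inner_add_right
      matrix_vector_mul_scaleR_left intro!: add_pos_nonneg)

lemma states_line_pos_def:
  assumes "pos_def \<sigma>" "psd (\<sigma> - x *\<^sub>R W)" "0 \<le> y" "y < x"
  shows "pos_def (\<sigma> - y *\<^sub>R W)"
proof -
  have "pos_def ((1 - y / x) *\<^sub>R \<sigma> + (y / x) *\<^sub>R (\<sigma> - x *\<^sub>R W))"
    using assms by (intro pos_def_convex) auto
  thus ?thesis using assms(3,4) by (simp add: algebra_simps)
qed

lemma pos_def_perturb:
  assumes A: "pos_def A" and W: "W \<in> Herm"
  obtains d where "0 < d" "psd (A - d *\<^sub>R W)"
proof -
  obtain c where c: "0 < c" "\<And>v. c * (v \<bullet> v) \<le> v \<bullet> (A *v v)"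
    using pos_def_bound[OF A] by blast
  define d where "d = c / (norm W + 1)"
  have nW: "0 < norm W + 1" by (simp add: add_nonneg_pos)
  have d: "0 < d" "d * norm W \<le> c" using c nW by (auto simp: d_def field_simps)
  have "0 \<le> v \<bullet> ((A - d *\<^sub>R W) *v v)" for v
  proof -
    have "d * (v \<bullet> (W *v v)) \<le> d * (norm W * (v \<bullet> v))"
      using quad_form_abs_le[of v W] d(1) by (intro mult_left_mono) auto
    also have "\<dots> \<le> c * (v \<bullet> v)"
      using mult_right_mono[OF d(2), of "v \<bullet> v"] by (simp add: mult.assoc)
    also have "\<dots> \<le> v \<bullet> (A *v v)" by (rule c)
    finally show ?thesis
      by (simp add: matrix_vector_mult_diff_rdistrib inner_diff_right matrix_vector_mul_scaleR_left)
  qed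
  hence "psd (A - d *\<^sub>R W)"
    using A W by (simp add: psd_iff Herm_diff Herm_scaleR pos_def_Herm)
  thus thesis using that d by blast
qed

text \<open>The parameters y \<ge> 0 with \<sigma> - y W positive semidefinite form a compact set.
  Its largest element gives a singular matrix, as a positive definite one could be pushed further.
  Every smaller parameter gives a convex combination with positive weight on \<sigma>, hence a
  nonsingular matrix. So the description defining \<open>x_max\<close> picks out this largest
  element.\<close>

lemma x_max_ge:
  assumes \<sigma>: "pos_def \<sigma>" "\<sigma> \<in> states" and W: "L_inv \<sigma> \<phi> \<in> Herm" "L_inv \<sigma> \<phi> \<noteq> 0"
    and x: "0 < x" "\<sigma> - x *\<^sub>R L_inv \<sigma> \<phi> \<in> states"
  shows "x \<le> x_max \<sigma> \<phi>"
proof -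
  define W where "W = L_inv \<sigma> \<phi>"
  \<comment> \<open>Two distinct parameters, 0 and \<open>x\<close>, give trace one on the line, so
    its direction is traceless and every positive semidefinite point on it is a state.\<close>
  have trW: "trace W = 0"
    using \<sigma>(2) x unfolding W_def[symmetric]
    by (auto simp: states_def trace_sub trace_scaleR)
  have st: "\<sigma> - y *\<^sub>R W \<in> states \<longleftrightarrow> psd (\<sigma> - y *\<^sub>R W)" for y
    using \<sigma>(2) by (simp add: states_def trace_sub trace_scaleR trW)
  define I where "I = {y. 0 \<le> y \<and> psd (\<sigma> - y *\<^sub>R W)}"
  have "closed I"
  proof -
    have "I = {0..} \<inter> ((\<lambda>y. \<sigma> - y *\<^sub>R W) -` {A. psd A})" by (auto simp: I_def)
    moreover have "closed ((\<lambda>y. \<sigma> - y *\<^sub>R W) -` {A. psd A})"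
      by (intro closed_vimage closed_psd continuous_intros)
    ultimately show ?thesis by (simp add: closed_Int)
  qed
  moreover have "bounded I"
  proof -
    \<comment> \<open>\<open>y *\<^sub>R W\<close> is the difference of two states, each of norm at
      most 1.\<close>
    have "norm y \<le> 2 / norm W" if "y \<in> I" for y
    proof -
      have "norm (y *\<^sub>R W) = norm (\<sigma> - (\<sigma> - y *\<^sub>R W))" by simp
      also have "\<dots> \<le> norm \<sigma> + norm (\<sigma> - y *\<^sub>R W)" by (rule norm_triangle_ineq4)
      also have "\<dots> \<le> 1 + 1"
        using norm_psd_le_trace[of \<sigma>] norm_psd_le_trace[of "\<sigma> - y *\<^sub>R W"] \<sigma>(2) that st[of y]
        unfolding I_def by (intro add_mono) (auto simp: states_def)
      finally show ?thesis using W(2) by (simp add: W_def field_simps)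
    qed
    thus ?thesis unfolding bounded_iff by blast
  qed
  moreover have xI: "x \<in> I" using x by (simp add: I_def W_def states_psd)
  ultimately obtain y where y: "y \<in> I" and ymax: "\<And>z. z \<in> I \<Longrightarrow> z \<le> y"
    using continuous_attains_sup[of I "\<lambda>y. y"] by (auto simp: compact_eq_bounded_closed)
  have y0: "0 < y" using x(1) ymax[OF xI] by simp
  have np: "\<not> pos_def (\<sigma> - y *\<^sub>R W)"
  proof
    assume "pos_def (\<sigma> - y *\<^sub>R W)"
    then obtain d where "0 < d" "psd (\<sigma> - y *\<^sub>R W - d *\<^sub>R W)"
      using pos_def_perturb W(1) unfolding W_def by blast
    hence "y + d \<in> I" using y0 by (simp add: I_def algebra_simps)
    thus False using ymax \<open>0 < d\<close> by fastforce
  qed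
  have not_singular: "A *v v \<noteq> 0" if "pos_def A" "v \<noteq> 0" for A and v :: "complex^'a"
    using that by (metis pos_def_iff inner_zero_right less_irrefl)
  have "x_max \<sigma> \<phi> = y" unfolding x_max_def W_def[symmetric]
  proof (rule the_equality)
    show "0 < y \<and> \<sigma> - y *\<^sub>R W \<in> states \<and> (\<exists>v. v \<noteq> 0 \<and> (\<sigma> - y *\<^sub>R W) *v v = 0)"
      using y0 y np psd_kernel_or_pos_def[of "\<sigma> - y *\<^sub>R W"] by (auto simp: st I_def)
  next
    fix z
    assume z: "0 < z \<and> \<sigma> - z *\<^sub>R W \<in> states \<and> (\<exists>v. v \<noteq> 0 \<and> (\<sigma> - z *\<^sub>R W) *v v = 0)"
    hence "z \<le> y" using ymax by (auto simp: I_def st)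
    moreover have "\<not> z < y"
      using states_line_pos_def[OF \<sigma>(1), of y W z] z y not_singular by (force simp: I_def)
    ultimately show "z = y" by simp
  qed
  thus ?thesis using ymax[OF xI] by simp
qed

section \<open>Relative entropy in terms of inner products\<close>

lemma rel_entropy_pos_def:
  assumes "\<rho> \<in> Herm" "pos_def \<sigma>"
  shows "rel_entropy \<rho> \<sigma> = ereal (\<rho> \<bullet> mat_log \<rho> - \<rho> \<bullet> mat_log \<sigma>)"
  using assms pos_def_kernel[OF assms(2)]
  by (simp add: rel_entropy_def kernel_def trace_sub trace_mult_Herm)

lemma rel_entropy_kernel:
  assumes "\<rho> \<in> Herm" "kernel \<sigma> \<subseteq> kernel \<rho>"
  shows "rel_entropy \<rho> \<sigma> = ereal (\<rho> \<bullet> mat_log \<rho> - \<rho> \<bullet> mat_log \<sigma>)"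
  using assms by (simp add: rel_entropy_def trace_sub trace_mult_Herm)

text \<open>
  The tangent inequality extends to singular \<open>B\<close> by continuity along \<open>B + s\<close>: the terms
  \<open>ln 0\<close> are weighted by zero because the kernel of \<open>B\<close> lies in that of \<open>\<rho>\<close>.
\<close>
lemma mat_log_tangent_psd:
  assumes \<rho>: "psd \<rho>" and A: "pos_def A" and B: "psd B" and ker: "kernel B \<subseteq> kernel \<rho>"
  shows "\<rho> \<bullet> mat_log B \<le> \<rho> \<bullet> mat_log A + \<rho> \<bullet> L_op A (B - A)"
proof -
  obtain U b where U: "unitary U" and B': "B = spectral U b" and b: "\<And>k. 0 \<le> b k"
    using psd_obtain_spectral[OF B] by blast
  define p where "p k = column k U \<bullet> (\<rho> *v column k U)" for k
  have p0: "p k = 0" if "b k = 0" for k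
    using spectral_column_eq_0[of U b, OF U that] ker by (auto simp: p_def kernel_def B')
  have AB: "A \<in> Herm" "B \<in> Herm" using A B by (simp_all add: pos_def_Herm psd_Herm)
  have le: "(\<Sum>k\<in>UNIV. ln (b k + s) * p k) \<le> \<rho> \<bullet> mat_log A + \<rho> \<bullet> L_op A (B - A) + s * (\<rho> \<bullet> L_op A (mat 1))"
    if s: "0 < s" for s
  proof -
    have "\<rho> \<bullet> mat_log (spectral U (\<lambda>k. b k + s)) = (\<Sum>k\<in>UNIV. ln (b k + s) * p k)"
      by (simp add: mat_log_spectral[OF U] inner_spectral p_def)
    moreover have "\<rho> \<bullet> mat_log (spectral U (\<lambda>k. b k + s))
        \<le> \<rho> \<bullet> mat_log A + \<rho> \<bullet> L_op A (spectral U (\<lambda>k. b k + s) - A)"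
      using b s by (intro mat_log_tangent[OF \<rho> A]) (simp add: pos_def_spectral[OF U] add_nonneg_pos)
    moreover have "L_op A (spectral U (\<lambda>k. b k + s) - A) = L_op A (B - A) + s *\<^sub>R L_op A (mat 1)"
    proof -
      have "spectral U (\<lambda>k. b k + s) - A = (B - A) - (- s) *\<^sub>R mat 1"
        by (simp add: spectral_shift[OF U] B')
      thus ?thesis using AB
        by (simp only: L_op_diff[OF A] L_op_scaleR[OF A] Herm_diff Herm_scaleR Herm_mat_1) simp
    qed
    ultimately show ?thesis by (simp add: inner_add_right)
  qed
  have "((\<lambda>s. ln (b k + s) * p k) \<longlongrightarrow> ln (b k) * p k) (at_right 0)" for k
  proof (cases "b k = 0")
    case False
    thus ?thesis by (intro tendsto_eq_intros) auto
  qed (simp add: p0)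
  hence "((\<lambda>s. \<Sum>k\<in>UNIV. ln (b k + s) * p k) \<longlongrightarrow> (\<Sum>k\<in>UNIV. ln (b k) * p k)) (at_right 0)"
    by (intro tendsto_sum)
  moreover have "((\<lambda>s. \<rho> \<bullet> mat_log A + \<rho> \<bullet> L_op A (B - A) + s * (\<rho> \<bullet> L_op A (mat 1)))
      \<longlongrightarrow> \<rho> \<bullet> mat_log A + \<rho> \<bullet> L_op A (B - A)) (at_right 0)"
    by (rule tendsto_eq_intros refl | simp)+
  ultimately have "(\<Sum>k\<in>UNIV. ln (b k) * p k) \<le> \<rho> \<bullet> mat_log A + \<rho> \<bullet> L_op A (B - A)"
    using le by (intro tendsto_le[OF trivial_limit_at_right_real]) (auto simp: eventually_at_filter)
  thus ?thesis by (simp add: B' mat_log_spectral[OF U] inner_spectral p_def)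
qed

section \<open>Closest states in a closed convex set\<close>

lemma inner_one_state: "\<rho> \<in> states \<Longrightarrow> mat 1 \<bullet> \<rho> = 1"
  by (simp add: inner_matrix_trace states_def)

text \<open>\<open>L_op A (mat 1)\<close> is the inverse of \<open>A\<close>. The sign is what
  allows the tangent term to be dropped when the base point of a tangent is moved from \<tau> to
  \<tau> + s.\<close>

lemma L_op_one_nonneg:
  assumes \<rho>: "psd \<rho>" and A: "pos_def A"
  shows "0 \<le> \<rho> \<bullet> L_op A (mat 1)"
proof -
  obtain U a where U: "unitary U" and A': "A = spectral U a" and a: "\<And>k. 0 < a k"
    and L: "\<And>\<beta>. \<beta> \<in> Herm \<Longrightarrow> L_op A \<beta> = dlog U a \<beta>"
    using pos_def_obtain_L_op[OF A] by metis
  have "L_op A (mat 1) = spectral U (\<lambda>k. 1 / a k)"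
    using hadamard_spectral[OF U, of _ "\<lambda>_. 1"]
    by (simp add: L Herm_mat_1 dlog_def spectral_const[OF U])
  moreover have "0 \<le> \<rho> \<bullet> spectral U (\<lambda>k. 1 / a k)"
    using \<rho> unfolding inner_spectral by (intro sum_nonneg) (simp add: psd_iff a less_imp_le)
  ultimately show ?thesis by simp
qed

text \<open>The interface common to separable and PPT states. The positive definite element makes
  the relative entropy finite somewhere on \<open>D\<close>, whatever \<rho> is.\<close>

locale convex_state_set =
  fixes D :: "(complex^'n^'n) set"
  assumes D_states: "D \<subseteq> states" and D_convex: "convex D" and D_closed: "closed D"
    and D_pos_def: "\<exists>\<sigma>\<in>D. pos_def \<sigma>"
begin

lemma D_Herm: "\<sigma> \<in> D \<Longrightarrow> \<sigma> \<in> Herm"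
  and D_psd: "\<sigma> \<in> D \<Longrightarrow> psd \<sigma>"
  using D_states states_Herm states_psd by blast+

lemma D_compact: "compact D"
  using compact_Int_closed[OF compact_states D_closed] D_states by (simp add: Int_absorb1)

lemma D_segment:
  assumes "\<sigma> \<in> D" "\<sigma>' \<in> D" "0 \<le> t" "t \<le> 1"
  shows "\<sigma> + t *\<^sub>R (\<sigma>' - \<sigma>) \<in> D"
proof -
  have "\<sigma> + t *\<^sub>R (\<sigma>' - \<sigma>) = (1 - t) *\<^sub>R \<sigma> + t *\<^sub>R \<sigma>'" by (simp add: algebra_simps)
  thus ?thesis using D_convex assms by (auto simp: convex_alt)
qed

lemma segment_pos_def:
  assumes "pos_def \<sigma>" "\<sigma>' \<in> D" "0 \<le> t" "t < 1"
  shows "pos_def (\<sigma> + t *\<^sub>R (\<sigma>' - \<sigma>))"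
proof -
  have "\<sigma> + t *\<^sub>R (\<sigma>' - \<sigma>) = (1 - t) *\<^sub>R \<sigma> + t *\<^sub>R \<sigma>'" by (simp add: algebra_simps)
  thus ?thesis using pos_def_convex[OF assms(1) D_psd[OF assms(2)] assms(3,4)] by simp
qed

lemma state_boundary_subset: "state_boundary D \<subseteq> D"
  unfolding state_boundary_def
proof (rule frontier_of_subset_closedin)
  have "D \<subseteq> {A \<in> Herm. trace A = 1}" using D_states states_Herm by (auto simp: states_def)
  thus "closedin (top_of_set {A \<in> Herm. trace A = 1}) D"
    using D_closed by (simp add: closed_subset)
qed

lemma rel_entropy_ent_eq_iff:
  assumes \<sigma>: "\<sigma> \<in> D"
  shows "rel_entropy_ent D \<rho> = rel_entropy \<rho> \<sigma> \<longleftrightarrow> (\<forall>\<sigma>'\<in>D. rel_entropy \<rho> \<sigma> \<le> rel_entropy \<rho> \<sigma>')"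
  unfolding rel_entropy_ent_def
  using INF_lower[OF \<sigma>, of "rel_entropy \<rho>"] INF_lower[of _ D "rel_entropy \<rho>"]
  by (metis INF_greatest antisym)

text \<open>Concavity makes the first-order condition sufficient: the tangent inequality compares
  \<sigma> with every \<sigma>', including singular ones. Conversely, a positive derivative along
  the segment towards \<sigma>' would produce a nearby element of \<open>D\<close> with smaller
  relative entropy.\<close>

lemma CSS_variational:
  assumes \<sigma>: "\<sigma> \<in> D" "pos_def \<sigma>" and \<rho>: "\<rho> \<in> states"
  shows "rel_entropy_ent D \<rho> = rel_entropy \<rho> \<sigma> \<longleftrightarrow> (\<forall>\<sigma>'\<in>D. \<rho> \<bullet> L_op \<sigma> (\<sigma>' - \<sigma>) \<le> 0)"
  unfolding rel_entropy_ent_eq_iff[OF \<sigma>(1)]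
proof (intro iffI ballI)
  fix \<sigma>'
  assume tangent: "\<forall>\<sigma>'\<in>D. \<rho> \<bullet> L_op \<sigma> (\<sigma>' - \<sigma>) \<le> 0" and \<sigma>': "\<sigma>' \<in> D"
  show "rel_entropy \<rho> \<sigma> \<le> rel_entropy \<rho> \<sigma>'"
  proof (cases "kernel \<sigma>' \<subseteq> kernel \<rho>")
    case True
    have "\<rho> \<bullet> mat_log \<sigma>' \<le> \<rho> \<bullet> mat_log \<sigma> + \<rho> \<bullet> L_op \<sigma> (\<sigma>' - \<sigma>)"
      by (rule mat_log_tangent_psd[OF states_psd[OF \<rho>] \<sigma>(2) D_psd[OF \<sigma>'] True])
    also have "\<dots> \<le> \<rho> \<bullet> mat_log \<sigma>" using tangent \<sigma>' by simp
    finally show ?thesis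
      by (simp add: rel_entropy_pos_def \<sigma> states_Herm[OF \<rho>] rel_entropy_kernel True)
  qed (simp add: rel_entropy_def)
next
  fix \<sigma>'
  assume min: "\<forall>\<sigma>'\<in>D. rel_entropy \<rho> \<sigma> \<le> rel_entropy \<rho> \<sigma>'" and \<sigma>': "\<sigma>' \<in> D"
  show "\<rho> \<bullet> L_op \<sigma> (\<sigma>' - \<sigma>) \<le> 0"
  proof (rule ccontr)
    assume pos: "\<not> ?thesis"
    have "\<sigma>' - \<sigma> \<in> Herm" using \<sigma> \<sigma>' by (simp add: Herm_diff D_Herm)
    from bounded_linear.has_vector_derivative[OF bounded_linear_inner_right mat_log_deriv[OF \<sigma>(2) this]]
    have "((\<lambda>t. \<rho> \<bullet> mat_log (\<sigma> + t *\<^sub>R (\<sigma>' - \<sigma>))) has_real_derivative \<rho> \<bullet> L_op \<sigma> (\<sigma>' - \<sigma>)) (at 0)"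
      by (simp add: has_real_derivative_iff_has_vector_derivative)
    from DERIV_pos_inc_right[OF this] pos obtain d where d: "0 < d"
      "\<And>h. 0 < h \<Longrightarrow> h < d \<Longrightarrow> \<rho> \<bullet> mat_log \<sigma> < \<rho> \<bullet> mat_log (\<sigma> + h *\<^sub>R (\<sigma>' - \<sigma>))"
      by auto
    \<comment> \<open>Besides \<open>h < d\<close>, the step must stay below 1: the far end
      \<sigma>' of the segment may be singular, while all earlier points are positive
      definite.\<close>
    define h where "h = min (d / 2) (1 / 2)"
    have h: "0 < h" "h < d" "h < 1" using d(1) by (auto simp: h_def)
    let ?\<tau> = "\<sigma> + h *\<^sub>R (\<sigma>' - \<sigma>)"
    have "?\<tau> \<in> D" "pos_def ?\<tau>"
      using D_segment[OF \<sigma>(1) \<sigma>', of h] segment_pos_def[OF \<sigma>(2) \<sigma>', of h] h by simp_all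
    hence "\<rho> \<bullet> mat_log ?\<tau> \<le> \<rho> \<bullet> mat_log \<sigma>"
      using min by (auto simp: rel_entropy_pos_def \<sigma> states_Herm[OF \<rho>] dest!: bspec[of _ _ ?\<tau>])
    thus False using d(2)[OF h(1,2)] by simp
  qed
qed

text \<open>Self-adjointness moves L_\<sigma> onto \<rho>, and L_\<sigma>(\<sigma>) = 1 turns the
  base-point term into the trace of \<rho>.\<close>

lemma CSS_iff_L_op_le_1:
  assumes \<sigma>: "\<sigma> \<in> D" "pos_def \<sigma>" and \<rho>: "\<rho> \<in> states"
  shows "rel_entropy_ent D \<rho> = rel_entropy \<rho> \<sigma> \<longleftrightarrow> (\<forall>\<sigma>'\<in>D. L_op \<sigma> \<rho> \<bullet> \<sigma>' \<le> 1)"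
proof -
  have "\<rho> \<bullet> L_op \<sigma> (\<sigma>' - \<sigma>) = L_op \<sigma> \<rho> \<bullet> \<sigma>' - 1" if "\<sigma>' \<in> D" for \<sigma>'
  proof -
    have "\<rho> \<bullet> L_op \<sigma> (\<sigma>' - \<sigma>) = \<rho> \<bullet> L_op \<sigma> \<sigma>' - \<rho> \<bullet> L_op \<sigma> \<sigma>"
      using that by (simp add: L_op_diff D_Herm \<sigma> inner_diff_right)
    also have "\<rho> \<bullet> L_op \<sigma> \<sigma>' = L_op \<sigma> \<rho> \<bullet> \<sigma>'"
      using that \<rho> by (simp add: L_op_inner \<sigma> states_Herm D_Herm)
    finally show ?thesis
      by (simp add: L_op_self[OF \<sigma>(2)] inner_commute[of \<rho>] inner_one_state[OF \<rho>])
  qed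
  thus ?thesis by (simp add: CSS_variational[OF assms])
qed

theorem CSS_criterion:
  assumes \<sigma>: "\<sigma> \<in> D" "pos_def \<sigma>" and \<rho>: "\<rho> \<in> states" "\<rho> \<noteq> \<sigma>"
  shows "rel_entropy_ent D \<rho> = rel_entropy \<rho> \<sigma> \<longleftrightarrow>
    (\<exists>\<phi>\<in>Herm. \<exists>x::real. (\<forall>\<sigma>'\<in>D. Re (trace (\<phi> ** \<sigma>')) \<ge> Re (trace (\<phi> ** \<sigma>))) \<and>
       trace (\<phi> ** \<sigma>) = 0 \<and> trace (\<phi> ** \<phi>) = 1 \<and> 0 < x \<and> x \<le> x_max \<sigma> \<phi> \<and>
       \<rho> = \<sigma> - x *\<^sub>R L_inv \<sigma> \<phi>)" (is "_ \<longleftrightarrow> ?R")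
proof
  have H: "\<sigma> \<in> Herm" "\<rho> \<in> Herm" and st: "\<sigma> \<in> states"
    using \<sigma> \<rho> D_Herm states_Herm D_states by auto
  assume "rel_entropy_ent D \<rho> = rel_entropy \<rho> \<sigma>"
  hence le1: "L_op \<sigma> \<rho> \<bullet> \<sigma>' \<le> 1" if "\<sigma>' \<in> D" for \<sigma>'
    using CSS_iff_L_op_le_1[OF \<sigma> \<rho>(1)] that by blast
  define \<xi> where "\<xi> = L_op \<sigma> (\<sigma> - \<rho>)"
  have \<xi>: "\<xi> = mat 1 - L_op \<sigma> \<rho>" by (simp add: \<xi>_def L_op_diff \<sigma> H L_op_self)
  have \<xi>H: "\<xi> \<in> Herm" by (simp add: \<xi>_def L_op_Herm \<sigma> Herm_diff H)
  have "\<xi> \<noteq> 0"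
  proof
    assume "\<xi> = 0"
    \<comment> \<open>Zero is written as a multiple of \<sigma> so that homogeneity evaluates the
      right side; injectivity on \<open>Herm\<close> then contradicts \<rho> \<noteq>
      \<sigma>.\<close>
    hence "L_op \<sigma> (\<sigma> - \<rho>) = L_op \<sigma> (0 *\<^sub>R \<sigma>)"
      unfolding \<xi>_def by (simp only: L_op_scaleR \<sigma> H) simp
    hence "\<sigma> - \<rho> = 0 *\<^sub>R \<sigma>"
      using L_inv_L_op[OF \<sigma>(2)] Herm_diff[OF H] Herm_scaleR[OF H(1)] by metis
    thus False using \<rho>(2) by simp
  qed
  define x where "x = norm \<xi>"
  define \<phi> where "\<phi> = (1 / x) *\<^sub>R \<xi>"
  have x: "0 < x" using \<open>\<xi> \<noteq> 0\<close> by (simp add: x_def)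
  have \<phi>H: "\<phi> \<in> Herm" by (simp add: \<phi>_def Herm_scaleR \<xi>H)
  have n1: "\<phi> \<bullet> \<phi> = 1"
    using x by (simp add: \<phi>_def dot_square_norm x_def power2_eq_square)
  have ip: "\<phi> \<bullet> \<tau> = (1 - L_op \<sigma> \<rho> \<bullet> \<tau>) / x" if "\<tau> \<in> D" for \<tau>
    using inner_one_state[of \<tau>] that D_states
    by (auto simp: \<phi>_def \<xi> inner_diff_left)
  \<comment> \<open>The pairing of L_\<sigma>(\<rho>) with \<sigma> is that of \<rho> with
    L_\<sigma>(\<sigma>) = 1, which is the trace of \<rho>; so the bound 1 is attained at
    \<sigma>.\<close>
  have s0: "\<phi> \<bullet> \<sigma> = 0"
    using ip[OF \<sigma>(1)] L_op_inner[OF \<sigma>(2) H(2) H(1)]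
    by (simp add: L_op_self \<sigma> inner_commute[of \<rho>] inner_one_state[OF \<rho>(1)])
  have L: "L_inv \<sigma> \<phi> = (1 / x) *\<^sub>R (\<sigma> - \<rho>)"
    using L_inv_L_op[OF \<sigma>(2) Herm_scaleR[OF Herm_diff[OF H], of "1 / x"]]
    by (simp add: \<phi>_def \<xi>_def L_op_scaleR[OF \<sigma>(2) Herm_diff[OF H]])
  have \<rho>eq: "\<rho> = \<sigma> - x *\<^sub>R L_inv \<sigma> \<phi>" using x by (simp add: L)
  have "x \<le> x_max \<sigma> \<phi>"
  proof (rule x_max_ge[OF \<sigma>(2) st L_inv_Herm[OF \<sigma>(2) \<phi>H] _ x])
    show "L_inv \<sigma> \<phi> \<noteq> 0" using x \<rho>(2) by (simp add: L)
    show "\<sigma> - x *\<^sub>R L_inv \<sigma> \<phi> \<in> states" using \<rho>(1) \<rho>eq by metis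
  qed
  moreover have "0 \<le> \<phi> \<bullet> \<tau>" if "\<tau> \<in> D" for \<tau>
    using le1[OF that] x by (simp add: ip[OF that])
  ultimately show ?R
    using \<phi>H \<rho>eq x
    by (intro bexI[of _ \<phi>] exI[of _ x]) (simp_all add: trace_mult_Herm_real H D_Herm n1 s0)
next
  assume ?R
  then obtain \<phi> x where \<phi>H: "\<phi> \<in> Herm" and ge: "\<And>\<tau>. \<tau> \<in> D \<Longrightarrow> 0 \<le> Re (trace (\<phi> ** \<tau>))"
    and x: "0 < x" and \<rho>eq: "\<rho> = \<sigma> - x *\<^sub>R L_inv \<sigma> \<phi>" by auto
  have "L_op \<sigma> \<rho> = mat 1 - x *\<^sub>R \<phi>"
    unfolding \<rho>eq
    by (simp add: L_op_diff L_op_scaleR L_op_self L_op_L_inv L_inv_Herm Herm_scaleR \<sigma> \<phi>H D_Herm)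
  moreover have "0 \<le> \<phi> \<bullet> \<tau>" if "\<tau> \<in> D" for \<tau>
    using ge[OF that] by (simp add: trace_mult_Herm \<phi>H)
  ultimately have "L_op \<sigma> \<rho> \<bullet> \<tau> \<le> 1" if "\<tau> \<in> D" for \<tau>
    using inner_one_state[of \<tau>] that D_states x by (auto simp: inner_diff_left)
  thus "rel_entropy_ent D \<rho> = rel_entropy \<rho> \<sigma>"
    by (simp add: CSS_iff_L_op_le_1[OF \<sigma> \<rho>(1)])
qed

section \<open>Existence and uniqueness for full-rank states\<close>

lemma rel_entropy_finite_iff:
  assumes "pos_def \<rho>" "\<sigma> \<in> D"
  shows "rel_entropy \<rho> \<sigma> \<noteq> \<infinity> \<longleftrightarrow> pos_def \<sigma>"
  using psd_kernel_or_pos_def[OF D_psd[OF assms(2)]] pos_def_kernel[OF assms(1)] pos_def_kernel[of \<sigma>]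
  by (auto simp: rel_entropy_def kernel_def)

text \<open>
  A maximizing sequence of \<open>\<rho> \<bullet> log \<sigma>\<close> is bounded by every tangent functional, hence so is its
  limit point \<open>\<tau>\<close>. The tangent at \<open>\<tau> + s\<close> with \<open>s \<longrightarrow> 0\<close> then shows that \<open>\<tau>\<close> is positive definite
  and attains the supremum.
\<close>
lemma log_maximizer_exists:
  assumes \<rho>: "pos_def \<rho>"
  obtains \<tau> where "\<tau> \<in> D" "pos_def \<tau>" "\<And>\<sigma>. \<sigma> \<in> D \<Longrightarrow> pos_def \<sigma> \<Longrightarrow> \<rho> \<bullet> mat_log \<sigma> \<le> \<rho> \<bullet> mat_log \<tau>"
proof -
  have \<rho>p: "psd \<rho>" and \<rho>H: "\<rho> \<in> Herm" using \<rho> by (simp_all add: pos_def_psd pos_def_Herm)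
  define P where "P = {\<sigma> \<in> D. pos_def \<sigma>}"
  define F where "F \<sigma> = \<rho> \<bullet> mat_log \<sigma>" for \<sigma>
  \<comment> \<open>With L_A placed on \<rho>, the right side is affine and continuous in \<sigma>,
    so it survives the passage to a limit point even if that point is singular.\<close>
  have tan: "F \<sigma> \<le> F A + L_op A \<rho> \<bullet> (\<sigma> - A)" if "\<sigma> \<in> P" "pos_def A" for \<sigma> A
    using mat_log_tangent[OF \<rho>p that(2), of \<sigma>] that L_op_inner[OF that(2) \<rho>H, of "\<sigma> - A"]
    by (simp add: F_def P_def Herm_diff D_Herm pos_def_Herm)
  obtain A0 where A0: "A0 \<in> P" using D_pos_def by (auto simp: P_def)
  obtain C where C: "\<And>\<sigma>. \<sigma> \<in> D \<Longrightarrow> norm \<sigma> \<le> C"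
    using compact_imp_bounded[OF D_compact] by (auto simp: bounded_iff)
  have "bdd_above (F ` P)"
  proof (rule bdd_aboveI2)
    fix \<sigma>
    assume \<sigma>: "\<sigma> \<in> P"
    have "F \<sigma> \<le> F A0 + L_op A0 \<rho> \<bullet> (\<sigma> - A0)" using tan[OF \<sigma>] A0 by (simp add: P_def)
    also have "\<dots> \<le> F A0 + norm (L_op A0 \<rho>) * norm (\<sigma> - A0)"
      by (simp add: norm_cauchy_schwarz)
    also have "\<dots> \<le> F A0 + norm (L_op A0 \<rho>) * (C + C)"
      using C[of \<sigma>] C[of A0] \<sigma> A0 norm_triangle_ineq4[of \<sigma> A0]
      by (intro add_left_mono mult_left_mono) (auto simp: P_def)
    finally show "F \<sigma> \<le> F A0 + norm (L_op A0 \<rho>) * (C + C)" .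
  qed
  define m where "m = Sup (F ` P)"
  have Fm: "F \<sigma> \<le> m" if "\<sigma> \<in> P" for \<sigma>
    unfolding m_def using that \<open>bdd_above (F ` P)\<close> by (rule cSUP_upper)
  have "\<exists>\<sigma>\<in>P. m - 1 / real (Suc j) < F \<sigma>" for j
    unfolding m_def using A0 \<open>bdd_above (F ` P)\<close>
    using less_cSup_iff[of "F ` P" "m - 1 / real (Suc j)"] by (auto simp: m_def)
  then obtain X where X: "\<And>j. X j \<in> P" "\<And>j. m - 1 / real (Suc j) < F (X j)" by metis
  obtain \<tau> r where \<tau>: "\<tau> \<in> D" and r: "strict_mono r" and lim: "(X \<circ> r) \<longlonglongrightarrow> \<tau>"
    using D_compact X(1) unfolding compact_def P_def by blast
  have m_le: "m \<le> F A + L_op A \<rho> \<bullet> (\<tau> - A)" if A: "pos_def A" for A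
  proof (rule LIMSEQ_le)
    have "(\<lambda>j. m - 1 / real (Suc j)) \<longlonglongrightarrow> m - 0"
      by (intro tendsto_intros LIMSEQ_Suc lim_inverse_n'[unfolded inverse_eq_divide])
    from LIMSEQ_subseq_LIMSEQ[OF this r] show "(\<lambda>j. m - 1 / real (Suc (r j))) \<longlonglongrightarrow> m"
      by (simp add: o_def)
    show "(\<lambda>j. F A + L_op A \<rho> \<bullet> ((X \<circ> r) j - A)) \<longlonglongrightarrow> F A + L_op A \<rho> \<bullet> (\<tau> - A)"
      by (intro tendsto_intros lim)
    show "\<exists>N. \<forall>n\<ge>N. m - 1 / real (Suc (r n)) \<le> F A + L_op A \<rho> \<bullet> ((X \<circ> r) n - A)"
      using order_trans[OF less_imp_le[OF X(2)] tan[OF X(1) A]] by simp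
  qed
  obtain U b where U: "unitary U" and \<tau>': "\<tau> = spectral U b" and b: "\<And>k. 0 \<le> b k"
    using psd_obtain_spectral[OF D_psd[OF \<tau>]] by blast
  define p where "p k = column k U \<bullet> (\<rho> *v column k U)" for k
  have p: "0 < p k" for k
    using \<rho> column_unitary_nonzero[OF U] by (simp add: p_def pos_def_iff)
  have m_le_sum: "m \<le> (\<Sum>k\<in>UNIV. ln (b k + s) * p k)" if s: "0 < s" for s
  proof -
    let ?A = "\<tau> + s *\<^sub>R mat 1"
    have A: "pos_def ?A" by (rule pos_def_add_scaled[OF D_psd[OF \<tau>] s])
    have "0 \<le> L_op ?A \<rho> \<bullet> mat 1"
      using L_op_one_nonneg[OF \<rho>p A] L_op_inner[OF A \<rho>H Herm_mat_1] by simp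
    hence "0 \<le> s * (L_op ?A \<rho> \<bullet> mat 1)" using s by simp
    moreover have "L_op ?A \<rho> \<bullet> (\<tau> - ?A) = - (s * (L_op ?A \<rho> \<bullet> mat 1))"
      by simp
    ultimately have "m \<le> F ?A" using m_le[OF A] by linarith
    also have "F ?A = (\<Sum>k\<in>UNIV. ln (b k + s) * p k)"
      by (simp add: F_def \<tau>' spectral_shift[OF U, symmetric] mat_log_spectral[OF U] inner_spectral p_def)
    finally show ?thesis .
  qed
  have bpos: "0 < b j" for j
  proof (rule ccontr)
    assume "\<not> 0 < b j"
    hence bj: "b j = 0" using b[of j] by simp
    define C' where "C' = (\<Sum>k\<in>UNIV - {j}. ln (b k + 1) * p k)"
    \<comment> \<open>Chosen so that the single term \<open>ln s * p j\<close> is at most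
      \<open>m - C' - 1\<close>. As \<open>s \<le> 1\<close>, the remaining terms total at most
      \<open>C'\<close>, and the whole sum falls below \<open>m\<close>.\<close>
    define s where "s = min 1 (exp ((m - C' - 1) / p j))"
    have s: "0 < s" "s \<le> 1" by (auto simp: s_def)
    have "ln s \<le> ln (exp ((m - C' - 1) / p j))" using s by (subst ln_le_cancel_iff) (auto simp: s_def)
    hence "ln s * p j \<le> m - C' - 1" using p[of j] by (simp add: pos_le_divide_eq)
    moreover have "(\<Sum>k\<in>UNIV - {j}. ln (b k + s) * p k) \<le> C'"
      unfolding C'_def
    proof (intro sum_mono mult_right_mono)
      fix k
      have "0 < b k + s" "b k + s \<le> b k + 1" using s b[of k] by auto
      thus "ln (b k + s) \<le> ln (b k + 1)" by simp
      show "0 \<le> p k" using p[of k] by simp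
    qed
    moreover have "(\<Sum>k\<in>UNIV. ln (b k + s) * p k) = ln s * p j + (\<Sum>k\<in>UNIV - {j}. ln (b k + s) * p k)"
      using sum.remove[of UNIV j "\<lambda>k. ln (b k + s) * p k"] by (simp add: bj)
    ultimately show False using m_le_sum[OF s(1)] by linarith
  qed
  have \<tau>p: "pos_def \<tau>" using bpos by (simp add: \<tau>' pos_def_spectral[OF U])
  have "m \<le> F \<tau>"
    using m_le[OF \<tau>p] by simp
  show thesis
  proof (rule that[OF \<tau> \<tau>p])
    fix \<sigma>
    assume "\<sigma> \<in> D" "pos_def \<sigma>"
    hence "F \<sigma> \<le> m" by (intro Fm) (simp add: P_def)
    thus "\<rho> \<bullet> mat_log \<sigma> \<le> \<rho> \<bullet> mat_log \<tau>" using \<open>m \<le> F \<tau>\<close> by (simp add: F_def)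
  qed
qed

text \<open>If \<sigma> and \<tau> were different minimizers, both would be positive definite, and
  strict tangents at their midpoint could be added. The linear terms cancel because the two
  directions are opposite, so the midpoint would beat the maximum.\<close>

theorem CSS_unique:
  assumes \<rho>: "pos_def \<rho>"
  shows "\<exists>!\<sigma>. is_CSS D \<rho> \<sigma>"
proof -
  have \<rho>H: "\<rho> \<in> Herm" using \<rho> by (rule pos_def_Herm)
  obtain \<tau> where \<tau>: "\<tau> \<in> D" "pos_def \<tau>"
    and max: "\<And>\<sigma>. \<sigma> \<in> D \<Longrightarrow> pos_def \<sigma> \<Longrightarrow> \<rho> \<bullet> mat_log \<sigma> \<le> \<rho> \<bullet> mat_log \<tau>"
    using log_maximizer_exists[OF \<rho>] by blast
  have "rel_entropy \<rho> \<tau> \<le> rel_entropy \<rho> \<sigma>" if "\<sigma> \<in> D" for \<sigma>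
  proof (cases "rel_entropy \<rho> \<sigma> = \<infinity>")
    case False
    hence "pos_def \<sigma>" using rel_entropy_finite_iff[OF \<rho> that] by simp
    thus ?thesis using max[OF that] by (simp add: rel_entropy_pos_def \<rho>H \<tau>)
  qed simp
  hence \<tau>_CSS: "is_CSS D \<rho> \<tau>"
    using rel_entropy_ent_eq_iff[OF \<tau>(1)] \<tau>(1) by (simp add: is_CSS_def)
  moreover have "\<sigma> = \<tau>" if \<sigma>: "is_CSS D \<rho> \<sigma>" for \<sigma>
  proof (rule ccontr)
    assume ne: "\<sigma> \<noteq> \<tau>"
    have \<sigma>D: "\<sigma> \<in> D" and eq: "rel_entropy \<rho> \<sigma> = rel_entropy \<rho> \<tau>"
      using \<sigma> \<tau>_CSS by (auto simp: is_CSS_def)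
    hence \<sigma>p: "pos_def \<sigma>"
      using rel_entropy_finite_iff[OF \<rho> \<sigma>D] rel_entropy_finite_iff[OF \<rho> \<tau>(1)] \<tau>(2) by simp
    define A where "A = \<sigma> + (1 / 2) *\<^sub>R (\<tau> - \<sigma>)"
    have A: "A \<in> D" "pos_def A"
      unfolding A_def using D_segment[OF \<sigma>D \<tau>(1), of "1 / 2"] segment_pos_def[OF \<sigma>p \<tau>(1), of "1 / 2"]
      by simp_all
    have dA: "\<sigma> - A = (1 / 2) *\<^sub>R (\<sigma> - \<tau>)" "\<tau> - A = (- 1 / 2) *\<^sub>R (\<sigma> - \<tau>)"
      by (simp_all add: A_def algebra_simps vec_eq_iff)
    have "\<sigma> \<noteq> A" "\<tau> \<noteq> A" using ne dA by auto
    hence "\<rho> \<bullet> mat_log \<sigma> < \<rho> \<bullet> mat_log A + \<rho> \<bullet> L_op A (\<sigma> - A)"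
      "\<rho> \<bullet> mat_log \<tau> < \<rho> \<bullet> mat_log A + \<rho> \<bullet> L_op A (\<tau> - A)"
      using mat_log_tangent_strict[OF \<rho> A(2)] \<sigma>p \<tau>(2) by auto
    moreover have "\<rho> \<bullet> L_op A (\<sigma> - A) + \<rho> \<bullet> L_op A (\<tau> - A) = 0"
      unfolding dA L_op_scaleR[OF A(2) Herm_diff[OF D_Herm[OF \<sigma>D] D_Herm[OF \<tau>(1)]]] by simp
    moreover have "\<rho> \<bullet> mat_log \<sigma> = \<rho> \<bullet> mat_log \<tau>"
      using eq by (simp add: rel_entropy_pos_def \<rho>H \<tau>(2) \<sigma>p)
    ultimately show False using max[OF A] by simp
  qed
  ultimately show ?thesis by blast
qed

end

section \<open>Separable and PPT states\<close>

lemma quad_form_hadamard_product: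
  "quad_form_on UNIV (\<lambda>k l. spectral U a $ k $ l * B $ k $ l) v =
    (\<Sum>m\<in>UNIV. of_real (a m) * quad_form_on UNIV (entries B) (\<lambda>k. v k * cnj (U $ k $ m)))"
proof -
  have spec: "spectral U a $ k $ l = (\<Sum>m\<in>UNIV. of_real (a m) * U $ k $ m * cnj (U $ l $ m))" for k l
    by (simp add: spectral_def matrix_matrix_mult_def[of "U ** diag_mat a"] diag_mat_mult_right
        scaleR_conv_of_real mult_ac)
  have "quad_form_on UNIV (\<lambda>k l. spectral U a $ k $ l * B $ k $ l) v =
    (\<Sum>k\<in>UNIV. \<Sum>l\<in>UNIV. \<Sum>m\<in>UNIV. of_real (a m) * (cnj (v k * cnj (U $ k $ m)) * B $ k $ l * (v l * cnj (U $ l $ m))))"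
    unfolding quad_form_on_def spec
    by (simp add: sum_distrib_left sum_distrib_right mult_ac)
  also have "\<dots> = (\<Sum>k\<in>UNIV. \<Sum>m\<in>UNIV. \<Sum>l\<in>UNIV. of_real (a m) * (cnj (v k * cnj (U $ k $ m)) * B $ k $ l * (v l * cnj (U $ l $ m))))"
    by (intro sum.cong refl sum.swap)
  also have "\<dots> = (\<Sum>m\<in>UNIV. \<Sum>k\<in>UNIV. \<Sum>l\<in>UNIV. of_real (a m) * (cnj (v k * cnj (U $ k $ m)) * B $ k $ l * (v l * cnj (U $ l $ m))))"
    by (rule sum.swap)
  finally show ?thesis by (simp only: quad_form_on_def sum_distrib_left)
qed

text \<open>The Schur product theorem: \<open>A\<close> is a nonnegative combination of rank-one
  projections, and entrywise multiplication of \<open>B\<close> by a rank-one term is a congruence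
  of \<open>B\<close> by a diagonal matrix.\<close>

lemma psd_Schur_product:
  assumes "psd A" "psd B"
  shows "psd (\<chi> k l. A $ k $ l * B $ k $ l)"
proof -
  obtain U a where A: "A = spectral U a" and a: "\<And>k. 0 \<le> a k"
    using psd_obtain_spectral[OF assms(1)] by blast
  have "hermitian_on UNIV (\<lambda>k l. A $ k $ l * B $ k $ l)"
    using assms unfolding psd_def psd_on_def hermitian_on_def by (metis complex_cnj_mult)
  moreover have "0 \<le> Re (quad_form_on UNIV (\<lambda>k l. A $ k $ l * B $ k $ l) v)" for v
    using assms(2) unfolding A quad_form_hadamard_product psd_def psd_on_def
    by (auto intro!: sum_nonneg simp: a)
  ultimately show ?thesis by (simp add: psd_def psd_on_def)
qed

text \<open>A tensor product, written in multi-indices, is an entrywise product of pullbacks of its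
  factors. The induction starts from the all-ones matrix, whose quadratic form is the squared
  modulus of the sum of the coordinates.\<close>

lemma psd_prod_entries:
  fixes M :: "'i \<Rightarrow> complex^'n^'n"
  assumes "finite I" "\<And>i. i \<in> I \<Longrightarrow> psd (M i)"
  shows "psd (\<chi> k l. \<Prod>i\<in>I. M i $ k $ l)"
  using assms
proof (induction I rule: finite_induct)
  case empty
  have "quad_form_on UNIV (\<lambda>_ _. 1) v = cnj (\<Sum>k\<in>UNIV. v k) * (\<Sum>k\<in>UNIV. v k)" for v :: "'n \<Rightarrow> complex"
    by (simp add: quad_form_on_def sum_product)
  hence "0 \<le> Re (quad_form_on UNIV (\<lambda>_ _. 1) v)" for v :: "'n \<Rightarrow> complex"
    by (simp del: cnj_sum)
  thus ?case by (simp add: psd_def psd_on_def hermitian_on_def)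
next
  case (insert i I)
  have "psd (\<chi> k l. M i $ k $ l * (\<chi> k l. \<Prod>i\<in>I. M i $ k $ l) $ k $ l)"
    by (rule psd_Schur_product) (use insert in auto)
  thus ?case using insert.hyps by simp
qed

text \<open>The map \<open>g\<close> repeats rows and columns, as many multi-indices share a
  component. The quadratic form of the pullback at \<open>v\<close> is that of \<open>A\<close> at
  the vector of sums of \<open>v\<close> over the fibres of \<open>g\<close>.\<close>

lemma psd_pullback:
  fixes g :: "'n::finite \<Rightarrow> 'i"
  assumes A: "psd_on I A" and I: "finite I" and g: "\<And>k. g k \<in> I"
  shows "psd (\<chi> k l. A (g k) (g l))"
proof -
  have gr: "(\<Sum>p\<in>I. \<Sum>k | g k = p. h k) = sum h UNIV" for h :: "'n \<Rightarrow> complex"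
    using sum.group[of UNIV I g h] I g by auto
  have "quad_form_on UNIV (\<lambda>k l. A (g k) (g l)) v = quad_form_on I A (\<lambda>p. \<Sum>k | g k = p. v k)" for v
  proof -
    have inner: "(\<Sum>q\<in>I. A p q * (\<Sum>l | g l = q. v l)) = (\<Sum>l\<in>UNIV. A p (g l) * v l)" for p
      unfolding gr[symmetric] by (simp add: sum_distrib_left)
    have "quad_form_on I A (\<lambda>p. \<Sum>k | g k = p. v k) =
        (\<Sum>p\<in>I. (\<Sum>k | g k = p. cnj (v k)) * (\<Sum>l\<in>UNIV. A p (g l) * v l))"
      by (simp add: quad_form_on_def mult.assoc inner flip: sum_distrib_left)
    also have "\<dots> = (\<Sum>p\<in>I. \<Sum>k | g k = p. cnj (v k) * (\<Sum>l\<in>UNIV. A (g k) (g l) * v l))"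
      by (intro sum.cong refl) (simp add: sum_distrib_right)
    also have "\<dots> = (\<Sum>k\<in>UNIV. cnj (v k) * (\<Sum>l\<in>UNIV. A (g k) (g l) * v l))"
      by (rule gr)
    finally show ?thesis by (simp add: quad_form_on_def sum_distrib_left mult.assoc)
  qed
  moreover have "hermitian_on UNIV (\<lambda>k l. A (g k) (g l))"
    using A g unfolding psd_on_def hermitian_on_def by blast
  ultimately show ?thesis using A by (simp add: psd_def psd_on_def)
qed

lemma state_on_cong:
  assumes "\<And>p q. p \<in> I \<Longrightarrow> q \<in> I \<Longrightarrow> A p q = B p q"
  shows "state_on I A \<longleftrightarrow> state_on I B"
  unfolding state_on_def psd_on_def hermitian_on_def quad_form_on_def
  by (simp add: assms cong: ball_cong sum.cong)

lemma state_on_diag: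
  assumes "state_on I A" "finite I" "p \<in> I"
  shows "0 \<le> Re (A p p)" "Re (A p p) \<le> 1"
proof -
  have nn: "0 \<le> Re (A q q)" if "q \<in> I" for q
  proof -
    have "quad_form_on I A (\<lambda>k. if k = q then 1 else 0) = A q q"
      using that assms(2) unfolding quad_form_on_def
      by (simp add: if_distrib[of cnj] if_distrib[of "\<lambda>x. x * _"] if_distrib[of "\<lambda>x. _ * x"] cong: if_cong)
    thus ?thesis using assms(1) unfolding state_on_def psd_on_def by metis
  qed
  show "0 \<le> Re (A p p)" by (rule nn[OF assms(3)])
  have "Re (A p p) \<le> (\<Sum>q\<in>I. Re (A q q))"
    using nn assms(2,3) by (intro member_le_sum) auto
  also have "\<dots> = 1" using assms(1) by (simp add: state_on_def flip: Re_sum)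
  finally show "Re (A p p) \<le> 1" .
qed

lemma pos_def_scaled_one: "0 < c \<Longrightarrow> pos_def (c *\<^sub>R mat 1)"
  by (simp add: pos_def_iff Herm_scaleR Herm_mat_1 matrix_vector_mul_scaleR_left)

section \<open>Separable and PPT states for a fixed tensor identification\<close>

context
  fixes ns :: "'s::finite \<Rightarrow> nat" and e :: "'n::finite \<Rightarrow> 's \<Rightarrow> nat"
  assumes e: "bij_betw e UNIV {f. \<forall>i. f i < ns i}"
begin

lemma e_less: "e k i < ns i"
  using e by (auto simp: bij_betw_def)

lemma e_inj: "e k = e l \<longleftrightarrow> k = l"
  using e by (auto simp: bij_betw_def inj_on_def)

text \<open>Positivity comes from the entrywise product of pullbacks. For the trace,
  \<open>e\<close> turns the sum over indices into one over all multi-indices, which factors into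
  the product of the traces.\<close>

lemma tensor_states:
  assumes A: "\<And>i. state_on {..<ns i} (A i)"
  shows "(tensor e A :: complex^'n^'n) \<in> states"
proof -
  have "psd (\<chi> k l. \<Prod>i\<in>UNIV. (\<chi> k l. A i (e k i) (e l i)) $ k $ l :: complex^'n^'n)"
    using A e_less by (intro psd_prod_entries) (auto intro!: psd_pullback simp: state_on_def)
  hence "psd (tensor e A :: complex^'n^'n)" by (simp add: tensor_def)
  moreover have "trace (tensor e A :: complex^'n^'n) = 1"
  proof -
    have "trace (tensor e A :: complex^'n^'n) = (\<Sum>k\<in>UNIV. \<Prod>i\<in>UNIV. A i (e k i) (e k i))"
      by (simp add: trace_def tensor_def)
    also have "\<dots> = (\<Sum>f\<in>{f. \<forall>i. f i < ns i}. \<Prod>i\<in>UNIV. A i (f i) (f i))"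
      by (rule sum.reindex_bij_betw[OF e])
    also have "{f. \<forall>i. f i < ns i} = PiE UNIV (\<lambda>i. {..<ns i})" by auto
    also have "(\<Sum>f\<in>PiE UNIV (\<lambda>i. {..<ns i}). \<Prod>i\<in>UNIV. A i (f i) (f i)) = (\<Prod>i\<in>UNIV. \<Sum>p<ns i. A i p p)"
      by (rule prod_sum_PiE[symmetric]) auto
    also have "\<dots> = 1" using A by (simp add: state_on_def)
    finally show ?thesis .
  qed
  ultimately show ?thesis by (simp add: states_def)
qed

text \<open>A crude uniform bound that confines factor states to a compact box. The factor is pulled
  back to the full index type, where the norm is at most the trace, and each of the
  \<open>CARD('n)\<close> diagonal entries is at most 1. Every \<open>p < ns i\<close> occurs as a
  component, by changing one entry of some multi-index.\<close>

lemma state_on_entry_le: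
  assumes A: "state_on {..<ns i} A" and "p < ns i" "q < ns i"
  shows "cmod (A p q) \<le> of_nat CARD('n)"
proof -
  have "\<exists>k. e k i = p" if "p < ns i" for p
  proof -
    have "(e undefined)(i := p) \<in> range e"
      using e that e_less by (simp add: bij_betw_def)
    thus ?thesis by (metis fun_upd_same imageE)
  qed
  then obtain k l where kl: "e k i = p" "e l i = q" using assms(2,3) by metis
  let ?M = "(\<chi> k l. A (e k i) (e l i)) :: complex^'n^'n"
  have "cmod (A p q) \<le> norm (?M $ k)"
    using Finite_Cartesian_Product.norm_nth_le[of "?M $ k" l] by (simp add: kl)
  also have "\<dots> \<le> norm ?M"
    by (rule Finite_Cartesian_Product.norm_nth_le)
  also have "\<dots> \<le> Re (trace ?M)"
    using A e_less by (intro norm_psd_le_trace psd_pullback) (auto simp: state_on_def)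
  also have "\<dots> \<le> (\<Sum>k\<in>(UNIV::'n set). 1)"
    unfolding trace_def Re_sum using state_on_diag(2)[OF A] e_less by (intro sum_mono) auto
  finally show ?thesis by simp
qed

text \<open>The factors are encoded as one function on \<open>'s \<times> nat \<times> nat\<close>.
  Tychonoff makes the box \<open>K0\<close> of closed discs compact, the state conditions cut out
  the closed set \<open>K\<close>, and \<open>T\<close> is continuous because each entry of the
  tensor is a finite product of coordinates.\<close>

lemma compact_product_states:
  "compact {tensor e A :: complex^'n^'n | A. \<forall>i. state_on {..<ns i} (A i)}"
proof -
  define T where "T = (\<lambda>F :: 's \<times> nat \<times> nat \<Rightarrow> complex. tensor e (\<lambda>i p q. F (i, p, q)) :: complex^'n^'n)"
  define K0 where "K0 = PiE (UNIV :: ('s \<times> nat \<times> nat) set) (\<lambda>_. cball (0::complex) (of_nat CARD('n)))"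
  define K where "K = {F. \<forall>i. state_on {..<ns i} (\<lambda>p q. F (i, p, q))}"
  have coord: "continuous_on UNIV (\<lambda>F. F x)" for x :: "'s \<times> nat \<times> nat"
    by (rule continuous_on_product_coordinates)
  have "compactin (product_topology (\<lambda>_. euclidean) UNIV) K0"
    unfolding K0_def by (simp add: compactin_PiE)
  hence "compact K0" by (simp add: euclidean_product_topology)
  moreover have "closed K"
  proof -
    have "K = (\<Inter>i. (\<Inter>p\<in>{..<ns i}. \<Inter>q\<in>{..<ns i}. {F. F (i, p, q) = cnj (F (i, q, p))}) \<inter>
      (\<Inter>v. {F. 0 \<le> Re (\<Sum>p<ns i. \<Sum>q<ns i. cnj (v p) * F (i, p, q) * v q)}) \<inter>
      {F. (\<Sum>p<ns i. F (i, p, p)) = 1})"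
      unfolding K_def state_on_def psd_on_def hermitian_on_def quad_form_on_def by blast
    thus ?thesis
      by (simp only:)
        (intro closed_Int closed_INT ballI closed_Collect_eq closed_Collect_le continuous_intros coord)
  qed
  ultimately have "compact (K0 \<inter> K)" by (rule compact_Int_closed)
  moreover have "continuous_on (K0 \<inter> K) T"
    unfolding T_def tensor_def
    by (intro continuous_intros continuous_on_subset[OF coord]) simp_all
  ultimately have "compact (T ` (K0 \<inter> K))" by (intro compact_continuous_image)
  moreover have "T ` (K0 \<inter> K) = {tensor e A | A. \<forall>i. state_on {..<ns i} (A i)}"
  proof (intro set_eqI iffI)
    fix X
    assume "X \<in> {tensor e A :: complex^'n^'n | A. \<forall>i. state_on {..<ns i} (A i)}"
    then obtain A where X: "X = tensor e A" and A: "\<And>i. state_on {..<ns i} (A i)" by blast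
    \<comment> \<open>Entries beyond \<open>ns i\<close> are arbitrary in \<open>A\<close> and would
      leave the box; setting them to 0 changes neither the state conditions nor the tensor
      product.\<close>
    define F where "F = (\<lambda>(i, p, q). if p < ns i \<and> q < ns i then A i p q else 0)"
    have "F \<in> K0"
      using state_on_entry_le[OF A] by (auto simp: F_def K0_def)
    moreover have "F \<in> K"
    proof -
      have "state_on {..<ns i} (\<lambda>p q. F (i, p, q)) \<longleftrightarrow> state_on {..<ns i} (A i)" for i
        by (rule state_on_cong) (simp add: F_def)
      thus ?thesis using A by (simp add: K_def)
    qed
    moreover have "T F = X"
      by (simp add: T_def F_def X tensor_def e_less)
    ultimately show "X \<in> T ` (K0 \<inter> K)" by blast
  qed (auto simp: T_def K_def)
  ultimately show ?thesis by simp
qed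

text \<open>In finite dimension the convex hull of the compact set of product states is compact,
  hence closed. The positive definite element is the product of the maximally mixed factor
  states.\<close>

lemma separable_convex_state_set: "convex_state_set (separable_states ns e :: (complex^'n^'n) set)"
proof
  let ?P = "{tensor e A :: complex^'n^'n | A. \<forall>i. state_on {..<ns i} (A i)}"
  show "separable_states ns e \<subseteq> (states :: (complex^'n^'n) set)"
    unfolding separable_states_def by (rule hull_minimal) (auto simp: tensor_states convex_states)
  show "convex (separable_states ns e :: (complex^'n^'n) set)"
    by (simp add: separable_states_def convex_convex_hull)
  show "closed (separable_states ns e :: (complex^'n^'n) set)"
    unfolding separable_states_def by (intro compact_imp_closed compact_convex_hull compact_product_states)
  define A where "A = (\<lambda>(i::'s) (p::nat) (q::nat). if p = q then complex_of_real (1 / ns i) else 0)"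
  have nspos: "0 < ns i" for i using e_less[of undefined i] by simp
  have "state_on {..<ns i} (A i)" for i
  proof -
    have "0 \<le> Re (quad_form_on {..<ns i} (A i) v)" for v
    proof -
      have "quad_form_on {..<ns i} (A i) v = (\<Sum>p<ns i. cnj (v p) * complex_of_real (1 / ns i) * v p)"
        unfolding quad_form_on_def A_def
        by (intro sum.cong refl)
          (simp add: if_distrib[of "\<lambda>x. x * _"] if_distrib[of "\<lambda>x. _ * x"] cong: if_cong)
      thus ?thesis by (auto intro!: sum_nonneg)
    qed
    thus ?thesis using nspos[of i]
      by (auto simp: state_on_def psd_on_def hermitian_on_def A_def)
  qed
  hence "tensor e A \<in> (separable_states ns e :: (complex^'n^'n) set)"
    unfolding separable_states_def by (intro hull_inc) auto
  moreover have "tensor e A = ((\<Prod>i\<in>UNIV. 1 / ns i) *\<^sub>R mat 1 :: complex^'n^'n)"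
  proof -
    have "(\<Prod>i\<in>UNIV. A i (e k i) (e l i)) = 0" if "k \<noteq> l" for k l
    proof -
      have "e k \<noteq> e l" using that by (simp add: e_inj)
      then obtain i where "e k i \<noteq> e l i" by (auto simp: fun_eq_iff)
      thus ?thesis by (intro prod_zero) (auto simp: A_def)
    qed
    moreover have "(\<Prod>i\<in>UNIV. A i (e k i) (e k i)) = (\<Prod>i\<in>UNIV. 1 / ns i) *\<^sub>R (1 :: complex)" for k
      by (simp add: A_def scaleR_conv_of_real)
    ultimately show ?thesis
      by (auto simp: vec_eq_iff tensor_def mat_def)
  qed
  moreover have "0 < (\<Prod>i\<in>UNIV. 1 / ns i)" using nspos by (intro prod_pos) simp
  ultimately show "\<exists>\<sigma>\<in>separable_states ns e. pos_def (\<sigma> :: complex^'n^'n)"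
    using pos_def_scaled_one by metis
qed

text \<open>Partial transposition is real-linear and continuous, so the PPT condition is a family of
  closed convex conditions. The maximally mixed state satisfies them all, being fixed by every
  partial transposition.\<close>

lemma PPT_convex_state_set: "convex_state_set (PPT_states e :: (complex^'n^'n) set)"
proof
  let ?pt = "partial_transpose e :: 's set \<Rightarrow> complex^'n^'n \<Rightarrow> complex^'n^'n"
  have PPT: "PPT_states e = states \<inter> (\<Inter>T. ?pt T -` {A. psd A})"
    by (auto simp: PPT_states_def)
  show "PPT_states e \<subseteq> (states :: (complex^'n^'n) set)" by (auto simp: PPT_states_def)
  have pt_lin: "?pt T (u *\<^sub>R A + v *\<^sub>R B) = u *\<^sub>R ?pt T A + v *\<^sub>R ?pt T B" for T u v A B
    by (simp add: partial_transpose_def vec_eq_iff)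
  show "convex (PPT_states e :: (complex^'n^'n) set)"
  proof (rule convexI)
    fix A B :: "complex^'n^'n" and u v :: real
    assume "A \<in> PPT_states e" "B \<in> PPT_states e" "0 \<le> u" "0 \<le> v" "u + v = 1"
    thus "u *\<^sub>R A + v *\<^sub>R B \<in> PPT_states e"
      using convexD[OF convex_states] by (auto simp: PPT_states_def pt_lin psd_add psd_scaleR)
  qed
  have "continuous_on UNIV (?pt T)" for T
    unfolding partial_transpose_def by (intro continuous_intros)
  thus "closed (PPT_states e :: (complex^'n^'n) set)"
    unfolding PPT
    by (intro closed_Int closed_INT ballI closed_vimage closed_psd compact_imp_closed compact_states)
  let ?I = "(1 / of_nat CARD('n)) *\<^sub>R mat 1 :: complex^'n^'n"
  have p: "pos_def ?I" by (rule pos_def_scaled_one) simp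
  have "?pt T ?I = ?I" for T
  proof -
    \<comment> \<open>Exchanging components of two multi-indices yields equal ones only if they were
      equal before, so the support of the identity matrix is preserved.\<close>
    have "inv e (\<lambda>i. if i \<in> T then e l i else e k i) = inv e (\<lambda>i. if i \<in> T then e k i else e l i) \<longleftrightarrow> k = l"
      for k l
    proof -
      have "(\<lambda>i. if i \<in> T then e l i else e k i) \<in> range e" "(\<lambda>i. if i \<in> T then e k i else e l i) \<in> range e"
        using e e_less by (auto simp: bij_betw_def)
      hence "inv e (\<lambda>i. if i \<in> T then e l i else e k i) = inv e (\<lambda>i. if i \<in> T then e k i else e l i) \<longleftrightarrow>
        (\<lambda>i. if i \<in> T then e l i else e k i) = (\<lambda>i. if i \<in> T then e k i else e l i)"
        by (intro inj_on_eq_iff[OF inj_on_inv_into[OF subset_refl]])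
      also have "\<dots> \<longleftrightarrow> e k = e l"
      proof -
        have "(if i \<in> T then e l i else e k i) = (if i \<in> T then e k i else e l i) \<longleftrightarrow> e k i = e l i" for i
          by auto
        thus ?thesis by (simp only: fun_eq_iff)
      qed
      finally show ?thesis by (simp add: e_inj)
    qed
    thus ?thesis by (simp add: partial_transpose_def vec_eq_iff mat_def)
  qed
  moreover have "?I \<in> states"
    unfolding states_def mem_Collect_eq trace_scaleR trace_I
    using p by (simp add: pos_def_psd scaleR_conv_of_real[of _ "of_nat _ :: complex"])
  ultimately have "?I \<in> PPT_states e"
    using p by (simp add: PPT_states_def pos_def_psd)
  thus "\<exists>\<sigma>\<in>PPT_states e. pos_def (\<sigma> :: complex^'n^'n)" using p by blast
qed

end

theorem theorem3:
  fixes ns :: "'s::finite \<Rightarrow> nat"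
    and e :: "'n::finite \<Rightarrow> 's \<Rightarrow> nat"
    and D :: "(complex^'n^'n) set"
  assumes e: "bij_betw e UNIV {f. \<forall>i. f i < ns i}"
    and D: "D = separable_states ns e \<or> D = PPT_states e"
  shows "(\<forall>\<sigma> \<rho>. \<sigma> \<in> state_boundary D \<longrightarrow> pos_def \<sigma> \<longrightarrow> \<rho> \<in> states \<longrightarrow> \<rho> \<noteq> \<sigma> \<longrightarrow>
           (rel_entropy_ent D \<rho> = rel_entropy \<rho> \<sigma> \<longleftrightarrow>
            (\<exists>\<phi>\<in>Herm. \<exists>x::real.
               (\<forall>\<sigma>'\<in>D. Re (trace (\<phi> ** \<sigma>')) \<ge> Re (trace (\<phi> ** \<sigma>))) \<and>
               trace (\<phi> ** \<sigma>) = 0 \<and>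
               trace (\<phi> ** \<phi>) = 1 \<and>
               0 < x \<and> x \<le> x_max \<sigma> \<phi> \<and>
               \<rho> = \<sigma> - x *\<^sub>R L_inv \<sigma> \<phi>)))
         \<and> (\<forall>\<rho>. \<rho> \<in> states \<longrightarrow> pos_def \<rho> \<longrightarrow> (\<exists>!\<sigma>. is_CSS D \<rho> \<sigma>))"
proof -
  interpret convex_state_set D
    using D separable_convex_state_set[OF e] PPT_convex_state_set[OF e] by blast
  show ?thesis
    using CSS_criterion CSS_unique state_boundary_subset by blast
qed

end
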